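(* Let $z\in\mathbf C$, $c\in\mathbf R\setminus\{0\}$, $m\in\mathbf N$, $m\geq2$, and let $v(x)=e^{zx+icx^m}$ for $x\in\mathbf R$. If $\frac1{m-1}<t\leq1$ then $$\mathrm{WF}^{t,t(m-1)}(v)=\{(x,cmx^{m-1})\in\mathbf R^2:\ x\neq0\}.$$
   Context: Dimension $d=1$. Notation: $\mathbf N=\{0,1,2,\dots\}$, $D^\beta=(-i)^{|\beta|}\partial^\beta$, $T^*\mathbf R^d\simeq\mathbf R^{2d}$. For $s,t>0$ with $s+t>1$, the (Beurling type) Gelfand--Shilov space $\Sigma_t^s(\mathbf R^d)$ consists of all $f\in C^\infty(\mathbf R^d)$ such that for every $h>0$ $$\|f\|_{\mathcal S_{t,h}^s}=\sup_{\alpha,\beta\in\mathbf N^d,\,x\in\mathbf R^d}\frac{|x^\alpha D^\beta f(x)|}{h^{|\alpha+\beta|}\alpha!^t\beta!^s}<\infty,$$ with the Fréchet topology given by these seminorms. $(\Sigma_t^s)'(\mathbf R^d)$ is its topological dual; the action $(u,\varphi)$ is conjugate linear in $\varphi$ and consistent with the $L^2$ inner product. When $0<t\leq1$, $s>0$, $s+t>1$, the function $v$ defines an element of $(\Sigma_t^s)'(\mathbf R)$ by integration. Short-time Fourier transform: with $T_xf(y)=f(y-x)$, $M_\xi f(y)=e^{i\langle y,\xi\rangle}f(y)$, set $V_\psi u(x,\xi)=(2\pi)^{-d/2}(u,M_\xi T_x\psi)$. Wave front set: for $u\in(\Sigma_t^s)'(\mathbf R^d)$ and a fixed $\psi\in\Sigma_t^s(\mathbf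 R^d)\setminus\{0\}$, $(x_0,\xi_0)\in T^*\mathbf R^d\setminus0$ satisfies $(x_0,\xi_0)\notin\mathrm{WF}^{t,s}(u)$ if there is an open set $U\subseteq T^*\mathbf R^d\setminus0$ containing $(x_0,\xi_0)$ such that $$\sup_{\lambda>0,\,(x,\xi)\in U}e^{r\lambda}|V_\psi u(\lambda^tx,\lambda^s\xi)|<\infty\quad\forall r>0.$$ The definition does not depend on the choice of $\psi$. $\mathrm{WF}^{t,t(m-1)}$ means $\mathrm{WF}^{t,s}$ with $s=t(m-1)$. *)

theory Defs
  imports "HOL-Analysis.Analysis"
begin

section \<open>Gelfand--Shilov spaces of Beurling type on the real line\<close>

definition nth_vderiv :: "nat \<Rightarrow> (real \<Rightarrow> complex) \<Rightarrow> real \<Rightarrow> complex" where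
  "nth_vderiv n = (\<lambda>f x. vector_derivative f (at x)) ^^ n"

definition D_op :: "nat \<Rightarrow> (real \<Rightarrow> complex) \<Rightarrow> real \<Rightarrow> complex" where
  "D_op n f x = (- \<i>) ^ n * nth_vderiv n f x"

definition smooth :: "(real \<Rightarrow> complex) \<Rightarrow> bool" where
  "smooth f \<longleftrightarrow> (\<forall>n x. nth_vderiv n f differentiable at x)"

text \<open>The supremum is taken in the extended nonnegative reals, so that it is meaningful
  (and possibly infinite) for every \<open>f\<close>.\<close>

definition GS_seminorm :: "real \<Rightarrow> real \<Rightarrow> real \<Rightarrow> (real \<Rightarrow> complex) \<Rightarrow> ennreal" where
  "GS_seminorm t s h f =
     (SUP (\<alpha>, \<beta>, x) \<in> (UNIV :: (nat \<times> nat \<times> real) set).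
        ennreal (cmod (of_real (x ^ \<alpha>) * D_op \<beta> f x)
                 / (h ^ (\<alpha> + \<beta>) * fact \<alpha> powr t * fact \<beta> powr s)))"

definition GS_space :: "real \<Rightarrow> real \<Rightarrow> (real \<Rightarrow> complex) set" where
  "GS_space t s = {f. smooth f \<and> (\<forall>h>0. GS_seminorm t s h f < \<infinity>)}"

definition GS_topology :: "real \<Rightarrow> real \<Rightarrow> (real \<Rightarrow> complex) topology" where
  "GS_topology t s = topology_generated_by
     {{g \<in> GS_space t s. GS_seminorm t s h (\<lambda>x. g x - f x) < ennreal e} | f h e.
        f \<in> GS_space t s \<and> h > 0 \<and> e > 0}"

text \<open>Elements of the dual act conjugate-linearly on test functions. A functional is modelled as
  a total map whose values outside \<open>GS_space t s\<close> are irrelevant.\<close>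

definition GS_dual :: "real \<Rightarrow> real \<Rightarrow> ((real \<Rightarrow> complex) \<Rightarrow> complex) set" where
  "GS_dual t s = {u.
     (\<forall>f\<in>GS_space t s. \<forall>g\<in>GS_space t s. u (\<lambda>x. f x + g x) = u f + u g) \<and>
     (\<forall>f\<in>GS_space t s. \<forall>a. u (\<lambda>x. a * f x) = cnj a * u f) \<and>
     continuous_map (GS_topology t s) euclidean u}"

definition functional_of :: "(real \<Rightarrow> complex) \<Rightarrow> (real \<Rightarrow> complex) \<Rightarrow> complex" where
  "functional_of v \<phi> = (LINT x|lborel. v x * cnj (\<phi> x))"

section \<open>Short-time Fourier transform and wave front set\<close>

definition translation :: "real \<Rightarrow> (real \<Rightarrow> complex) \<Rightarrow> real \<Rightarrow> complex" where
  "translation x f y = f (y - x)"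

definition modulation :: "real \<Rightarrow> (real \<Rightarrow> complex) \<Rightarrow> real \<Rightarrow> complex" where
  "modulation \<xi> f y = exp (\<i> * of_real (y * \<xi>)) * f y"

definition STFT ::
    "(real \<Rightarrow> complex) \<Rightarrow> ((real \<Rightarrow> complex) \<Rightarrow> complex) \<Rightarrow> real \<Rightarrow> real \<Rightarrow> complex" where
  "STFT \<psi> u x \<xi> = of_real ((2 * pi) powr (- 1 / 2)) * u (modulation \<xi> (translation x \<psi>))"

text \<open>The wave front set of \<open>u \<in> GS_dual t s\<close> computed with the window \<open>\<psi>\<close>, a nonzero element
  of \<open>GS_space t s\<close>. It is a subset of the phase space without the origin.\<close>

definition WF ::
    "(real \<Rightarrow> complex) \<Rightarrow> real \<Rightarrow> real \<Rightarrow> ((real \<Rightarrow> complex) \<Rightarrow> complex) \<Rightarrow> (real \<times> real) set" where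
  "WF \<psi> t s u = {p. p \<noteq> (0, 0) \<and>
     \<not> (\<exists>U. open U \<and> U \<subseteq> UNIV - {(0, 0)} \<and> p \<in> U \<and>
           (\<forall>r>0. bdd_above {exp (r * l) * cmod (STFT \<psi> u (l powr t * x) (l powr s * \<xi>))
                              | l x \<xi>. l > 0 \<and> (x, \<xi>) \<in> U}))}"

section \<open>Functions of exponential growth define functionals\<close>

lemma GS_seminorm_boundD:
  assumes "GS_seminorm t s h g \<le> ennreal N" "h > 0" "N \<ge> 0"
  shows "\<bar>x\<bar> ^ n * cmod (g x) \<le> N * h ^ n * fact n powr t"
proof -
  have "ennreal (cmod (of_real (x ^ n) * D_op 0 g x)
                 / (h ^ (n + 0) * fact n powr t * fact 0 powr s)) \<le> GS_seminorm t s h g"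
    unfolding GS_seminorm_def by (rule SUP_upper2[where i = "(n, 0, x)"]) auto
  also have "\<dots> \<le> ennreal N" by fact
  finally have "cmod (of_real (x ^ n) * D_op 0 g x) / (h ^ n * fact n powr t) \<le> N"
    using assms by (simp add: ennreal_le_iff)
  then show ?thesis
    using assms by (simp add: D_op_def nth_vderiv_def divide_le_eq norm_mult norm_power mult_ac)
qed

lemma GS_decay:
  assumes N: "GS_seminorm t s h g \<le> ennreal N" "N \<ge> 0" and t: "t \<le> 1"
    and a: "a > 0" "h = 1 / (2 * a)"
  shows "cmod (g x) \<le> 2 * N * exp (- a * \<bar>x\<bar>)"
proof -
  have h: "h > 0" using a by simp
  have 1: "(\<lambda>n. (a * \<bar>x\<bar>) ^ n /\<^sub>R fact n * cmod (g x)) sums (exp (a * \<bar>x\<bar>) * cmod (g x))"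
    by (intro sums_mult2 exp_converges)
  have 2: "(\<lambda>n. N * (1 / 2) ^ n) sums (N * 2)"
    using sums_mult[OF geometric_sums[of "1/2::real"], of N] by simp
  have "(a * \<bar>x\<bar>) ^ n /\<^sub>R fact n * cmod (g x) \<le> N * (1 / 2) ^ n" for n
  proof -
    have "\<bar>x\<bar> ^ n * cmod (g x) \<le> N * h ^ n * fact n powr t"
      by (rule GS_seminorm_boundD) (use N h in auto)
    also have "\<dots> \<le> N * h ^ n * fact n powr 1"
      by (intro mult_left_mono powr_mono) (use t N h in auto)
    finally have "a ^ n * (\<bar>x\<bar> ^ n * cmod (g x)) \<le> a ^ n * (N * h ^ n * fact n)"
      using a by (intro mult_left_mono) auto
    also have "\<dots> = N * (a * h) ^ n * fact n" by (simp add: power_mult_distrib)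
    also have "a * h = 1 / 2" using a by simp
    finally show ?thesis by (simp add: field_simps power_mult_distrib)
  qed
  from sums_le[OF this 1 2] have "exp (a * \<bar>x\<bar>) * cmod (g x) \<le> 2 * N" by simp
  then show ?thesis
    by (simp add: exp_minus field_simps)
qed

lemma integrable_exp_minus_abs: "integrable lborel (\<lambda>x::real. exp (- \<bar>x\<bar>))"
proof -
  define f :: "real \<Rightarrow> real" where "f x = indicator {0..} x * exp (- x)" for x
  have "(\<lambda>x::real. exp (- x)) absolutely_integrable_on {0..}"
    using integrable_on_exp_minus_to_infinity[of 1 0]
    by (intro nonnegative_absolutely_integrable_1) auto
  then have "integrable lebesgue f"
    by (simp add: set_integrable_def f_def[abs_def])
  moreover have "f \<in> borel_measurable lborel"
    unfolding f_def[abs_def] by measurable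
  ultimately have f: "integrable lborel f"
    by (simp add: integrable_completion)
  then have "integrable lborel (\<lambda>x. f x + f (0 + (- 1) * x))"
    by (intro Bochner_Integration.integrable_add lborel_integrable_real_affine) auto
  then show ?thesis
    by (rule Bochner_Integration.integrable_bound) (auto simp: f_def indicator_def)
qed

lemma GS_space_continuous: "f \<in> GS_space t s \<Longrightarrow> continuous_on UNIV f"
proof -
  assume "f \<in> GS_space t s"
  then have "\<forall>x. nth_vderiv 0 f differentiable at x" by (auto simp: GS_space_def smooth_def)
  then show ?thesis
    by (auto simp: nth_vderiv_def intro!: continuous_at_imp_continuous_on
        differentiable_imp_continuous_within)
qed

lemma functional_of_bound:
  assumes v: "continuous_on UNIV v" "\<And>x. cmod (v x) \<le> exp (b * \<bar>x\<bar>)" "b \<ge> 0"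
    and g: "continuous_on UNIV g" "GS_seminorm t s (1 / (2 * (b + 1))) g \<le> ennreal N" "N \<ge> 0"
    and t: "t \<le> 1"
  shows "integrable lborel (\<lambda>x. v x * cnj (g x))" (is ?A)
    and "cmod (functional_of v g) \<le> 2 * N * (LINT x|lborel. exp (- \<bar>x\<bar>))" (is ?B)
proof -
  have le: "cmod (v x * cnj (g x)) \<le> 2 * N * exp (- \<bar>x\<bar>)" for x
  proof -
    have "cmod (v x) * cmod (g x) \<le> exp (b * \<bar>x\<bar>) * (2 * N * exp (- (b + 1) * \<bar>x\<bar>))"
      by (intro mult_mono GS_decay[OF g(2,3) t]) (use v g in auto)
    also have "\<dots> = 2 * N * (exp (b * \<bar>x\<bar>) * exp (- (b + 1) * \<bar>x\<bar>))" by simp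
    also have "exp (b * \<bar>x\<bar>) * exp (- (b + 1) * \<bar>x\<bar>) = exp (- \<bar>x\<bar>)"
      by (simp add: exp_add[symmetric] algebra_simps)
    finally show ?thesis by (simp add: norm_mult)
  qed
  have int: "integrable lborel (\<lambda>x::real. 2 * N * exp (- \<bar>x\<bar>))"
    by (intro integrable_mult_right integrable_exp_minus_abs)
  have "continuous_on UNIV (\<lambda>x. v x * cnj (g x))"
    by (intro continuous_intros v g)
  then have meas: "(\<lambda>x. v x * cnj (g x)) \<in> borel_measurable lborel"
    by (simp add: borel_measurable_continuous_onI)
  show ?A
    by (rule Bochner_Integration.integrable_bound[OF int meas]) (use le g in auto)
  have "cmod (functional_of v g) \<le> (LINT x|lborel. 2 * N * exp (- \<bar>x\<bar>))"
    unfolding functional_of_def by (rule Bochner_Integration.integral_norm_bound_integral[OF \<open>?A\<close> int le])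
  then show ?B by simp
qed

lemma functional_of_in_GS_dual:
  assumes v: "continuous_on UNIV v" "\<And>x. cmod (v x) \<le> exp (b * \<bar>x\<bar>)" "b \<ge> 0"
    and t: "t \<le> 1"
  shows "functional_of v \<in> GS_dual t s"
proof -
  define h where "h = 1 / (2 * (b + 1))"
  define J where "J = (LINT x|lborel. exp (- \<bar>x::real\<bar>))"
  have h: "h > 0" using v by (simp add: h_def)
  have J: "J \<ge> 0" unfolding J_def by simp
  have int: "integrable lborel (\<lambda>x. v x * cnj (f x))" if "f \<in> GS_space t s" for f
  proof -
    have "GS_seminorm t s h f < \<infinity>" using that h by (auto simp: GS_space_def)
    then have "GS_seminorm t s h f \<le> ennreal (enn2real (GS_seminorm t s h f))" by simp
    then show ?thesis
      by (intro functional_of_bound(1)[OF v GS_space_continuous[OF that]])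
         (use t in \<open>auto simp: h_def\<close>)
  qed
  have "functional_of v (\<lambda>x. f x + g x) = functional_of v f + functional_of v g"
    if "f \<in> GS_space t s" "g \<in> GS_space t s" for f g
    using int[OF that(1)] int[OF that(2)]
    by (simp add: functional_of_def distrib_left)
  moreover have "functional_of v (\<lambda>x. a * f x) = cnj a * functional_of v f" for f a
    by (simp add: functional_of_def mult.left_commute)
  moreover have "continuous_map (GS_topology t s) euclidean (functional_of v)"
    unfolding continuous_map_def
  proof (intro conjI allI impI)
    fix W :: "complex set" assume W: "openin euclidean W"
    have sub: "topspace (GS_topology t s) \<subseteq> GS_space t s"
      by (auto simp: GS_topology_def)
    show "openin (GS_topology t s) {f \<in> topspace (GS_topology t s). functional_of v f \<in> W}"
    proof (subst openin_subopen, intro ballI)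
      fix f assume f: "f \<in> {f \<in> topspace (GS_topology t s). functional_of v f \<in> W}"
      then have fG: "f \<in> GS_space t s" using sub by auto
      from f W obtain \<delta> where \<delta>: "\<delta> > 0" "ball (functional_of v f) \<delta> \<subseteq> W"
        by (auto simp: open_contains_ball)
      define e where "e = \<delta> / (2 * J + 1)"
      have e: "e > 0" "2 * e * J < \<delta>" using \<delta> J by (auto simp: e_def field_simps)
      define B where "B = {g \<in> GS_space t s. GS_seminorm t s h (\<lambda>x. g x - f x) < ennreal e}"
      have B: "openin (GS_topology t s) B"
        unfolding GS_topology_def B_def
        by (rule topology_generated_by_Basis) (use fG h e in blast)
      have "GS_seminorm t s h (\<lambda>x. f x - f x) = 0"
      proof -
        have "nth_vderiv n (\<lambda>x. 0) = (\<lambda>x. 0)" for n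
          by (induction n) (auto simp: nth_vderiv_def)
        then show ?thesis by (simp add: GS_seminorm_def D_op_def case_prod_beta)
      qed
      then have "f \<in> B" using fG e by (auto simp: B_def)
      moreover have "B \<subseteq> {f \<in> topspace (GS_topology t s). functional_of v f \<in> W}"
      proof
        fix g assume g: "g \<in> B"
        then have gG: "g \<in> GS_space t s" by (auto simp: B_def)
        have "functional_of v g - functional_of v f = functional_of v (\<lambda>x. g x - f x)"
          using int[OF gG] int[OF fG] by (simp add: functional_of_def right_diff_distrib)
        also have "cmod \<dots> \<le> 2 * e * J"
          unfolding J_def
        proof (rule functional_of_bound(2)[OF v])
          show "continuous_on UNIV (\<lambda>x. g x - f x)"
            by (intro continuous_on_diff GS_space_continuous[OF fG] GS_space_continuous[OF gG])
          show "GS_seminorm t s (1 / (2 * (b + 1))) (\<lambda>x. g x - f x) \<le> ennreal e"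
            using g by (auto simp: B_def h_def intro: order_less_imp_le)
        qed (use e t in auto)
        finally have "functional_of v g \<in> W"
          using e \<delta> by (auto simp: dist_norm norm_minus_commute subset_iff)
        then show "g \<in> {f \<in> topspace (GS_topology t s). functional_of v f \<in> W}"
          using B g openin_subset by blast
      qed
      ultimately show "\<exists>T. openin (GS_topology t s) T \<and> f \<in> T \<and>
          T \<subseteq> {f \<in> topspace (GS_topology t s). functional_of v f \<in> W}"
        using B by blast
    qed
  qed auto
  ultimately show ?thesis by (auto simp: GS_dual_def)
qed

lemma exp_phase_in_GS_dual:
  fixes z :: complex and c :: real
  assumes "t \<le> 1"
  shows "functional_of (\<lambda>x. exp (z * of_real x + \<i> * of_real c * of_real x ^ m)) \<in> GS_dual t s"
proof (rule functional_of_in_GS_dual[where b = "cmod z"])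
  fix x :: real
  have "Re (\<i> * of_real c * of_real x ^ m) = 0"
    by (simp flip: of_real_power of_real_mult)
  moreover have "Re z * x \<le> cmod z * \<bar>x\<bar>"
    by (rule order_trans[OF abs_ge_self]) (simp add: abs_mult abs_Re_le_cmod mult_right_mono)
  ultimately show "cmod (exp (z * of_real x + \<i> * of_real c * of_real x ^ m)) \<le> exp (cmod z * \<bar>x\<bar>)"
    by simp
qed (use assms in \<open>auto intro!: continuous_intros\<close>)

end

theory Submission
  imports
    Defs
    "HOL-Complex_Analysis.Cauchy_Integral_Formula"
    "HOL-Probability.Characteristic_Functions"
    "HOL-Real_Asymp.Real_Asymp"
begin

text \<open>
  Put \<open>s = t (m - 1)\<close>; the hypotheses force \<open>s > 1\<close>. The short-time Fourier transform is the
  integral of \<open>exp (\<Phi> y) * cnj (\<psi> (y - X))\<close> with \<open>\<Phi> y = z y + \<i> c y^m - \<i> \<xi> y\<close>.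

  Away from the curve \<open>\<xi> = c m x^(m - 1)\<close> one has \<open>\<bar>\<Phi>'\<bar> \<ge> \<epsilon> \<lambda>^s\<close> on the complex disc
  \<open>\<bar>y - \<lambda>^t x\<bar> \<le> 2 \<delta> \<lambda>^t\<close>, so the Cauchy inequalities control all derivatives of \<open>1 / \<Phi>'\<close> and
  \<open>N\<close> integrations by parts gain a factor \<open>(h^N N! / \<lambda>^N)^s\<close> with \<open>h\<close> as small as desired; take
  \<open>N = \<lfloor>\<lambda>\<rfloor>\<close>. No cut-off is needed, because all derivatives of \<open>\<psi>\<close> are \<open>O(exp (- a \<lambda>))\<close> at
  distance \<open>\<delta> \<lambda>^t\<close>, which takes care of the boundary terms and of the outer region.

  At a point \<open>(x\<^sub>0, \<xi>\<^sub>0)\<close> of the curve choose \<open>w\<^sub>0\<close> with \<open>\<psi> w\<^sub>0 \<noteq> 0\<close> and average the transform at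
  \<open>X = \<lambda>^t x\<^sub>0 - w\<^sub>0\<close> over \<open>\<xi>\<close> with a Gaussian weight of variance \<open>\<lambda>^s\<close> around \<open>\<lambda>^s \<xi>\<^sub>0\<close>. In \<open>y\<close>
  this localises to width \<open>\<lambda>^(-s/2)\<close> around the stationary point \<open>\<lambda>^t x\<^sub>0\<close>, where the phase is
  constant up to \<open>O(\<lambda>^(-t))\<close>. So the average is asymptotic to a nonzero multiple of
  \<open>exp (\<Phi> (\<lambda>^t x\<^sub>0)) * cnj (\<psi> w\<^sub>0)\<close>, which decays at most at a fixed exponential rate. Since \<open>s > 1\<close>,
  the Gaussian mass outside a conic neighbourhood of \<open>\<xi>\<^sub>0\<close> is superexponentially small, so decay at
  every exponential rate near \<open>(x\<^sub>0, \<xi>\<^sub>0)\<close> is impossible.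
\<close>

section \<open>Repeated integration by parts\<close>

text \<open>The families \<open>F\<close> and \<open>G\<close> list a function with all its
  derivatives, indexed by the order; for such families this is the \<open>n\<close>-th derivative of
  \<open>F 0 * G 0\<close>. Bounds on all orders can then be propagated pointwise, without iterating
  \<open>vector_derivative\<close>.\<close>

definition leibniz :: "(nat \<Rightarrow> real \<Rightarrow> complex) \<Rightarrow> (nat \<Rightarrow> real \<Rightarrow> complex) \<Rightarrow> nat \<Rightarrow> real \<Rightarrow> complex"
  where "leibniz F G n x = (\<Sum>i\<le>n. of_nat (n choose i) * F (n - i) x * G i x)"

lemma has_vector_derivative_leibniz:
  assumes F: "\<And>n. (F n has_vector_derivative F (Suc n) x) (at x within S)"
    and G: "\<And>n. (G n has_vector_derivative G (Suc n) x) (at x within S)"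
  shows "(leibniz F G n has_vector_derivative leibniz F G (Suc n) x) (at x within S)"
proof -
  define a where "a i j = F i x * G j x" for i j
  have "(leibniz F G n has_vector_derivative
      (\<Sum>i\<le>n. of_nat (n choose i) * (F (n - i) x * G (Suc i) x + F (Suc (n - i)) x * G i x)))
      (at x within S)"
    unfolding leibniz_def[abs_def] mult.assoc
    by (intro has_vector_derivative_sum has_vector_derivative_mult_right has_vector_derivative_mult F G)
  also have "(\<Sum>i\<le>n. of_nat (n choose i) * (F (n - i) x * G (Suc i) x + F (Suc (n - i)) x * G i x))
     = (\<Sum>i\<le>n. of_nat (n choose i) * a (n - i) (Suc i)) + (\<Sum>i\<le>n. of_nat (n choose i) * a (Suc n - i) i)"
    by (simp add: a_def sum.distrib distrib_left Suc_diff_le)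
  \<comment> \<open>The summand added at \<open>i = Suc n\<close> vanishes, since
    \<open>n choose Suc n = 0\<close>. After the index shift both sums run over the same range and
    Pascal's rule joins them.\<close>
  also have "(\<Sum>i\<le>n. of_nat (n choose i) * a (Suc n - i) i) =
      (\<Sum>i\<le>Suc n. of_nat (n choose i) * a (Suc n - i) i)"
    by simp
  also have "\<dots> = a (Suc n) 0 + (\<Sum>i\<le>n. of_nat (n choose Suc i) * a (n - i) (Suc i))"
    by (subst sum.atMost_Suc_shift) simp
  also have "(\<Sum>i\<le>n. of_nat (n choose i) * a (n - i) (Suc i)) + \<dots> =
      a (Suc n) 0 + (\<Sum>i\<le>n. of_nat (Suc n choose Suc i) * a (n - i) (Suc i))"
    by (simp add: sum.distrib distrib_right)
  also have "\<dots> = (\<Sum>i\<le>Suc n. of_nat (Suc n choose i) * a (Suc n - i) i)"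
    by (subst sum.atMost_Suc_shift) simp
  also have "\<dots> = leibniz F G (Suc n) x" by (simp only: leibniz_def a_def mult.assoc)
  finally show ?thesis .
qed

text \<open>\<open>ibp b f k j\<close> is the \<open>j\<close>-th derivative of \<open>L^k f\<close>, where \<open>L f = - (b f)'\<close> is the adjoint
  of \<open>b d/dx\<close>; the arguments \<open>f\<close> and \<open>b\<close> list all derivatives of the two functions.\<close>

primrec ibp :: "(nat \<Rightarrow> real \<Rightarrow> complex) \<Rightarrow> (nat \<Rightarrow> real \<Rightarrow> complex) \<Rightarrow> nat \<Rightarrow> nat \<Rightarrow> real \<Rightarrow> complex"
  where
    "ibp b f 0 = f"
  | "ibp b f (Suc k) = (\<lambda>j x. - leibniz (ibp b f k) b (Suc j) x)"

lemma has_vector_derivative_ibp: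
  assumes "\<And>n. (f n has_vector_derivative f (Suc n) x) (at x within S)"
    and "\<And>n. (b n has_vector_derivative b (Suc n) x) (at x within S)"
  shows "(ibp b f k j has_vector_derivative ibp b f k (Suc j) x) (at x within S)"
proof (induction k arbitrary: j)
  case (Suc k)
  then show ?case
    by (auto intro!: has_vector_derivative_minus has_vector_derivative_leibniz assms)
qed (use assms in simp)

text \<open>The quotient of factorials is a product of \<open>i\<close> factors, each of which grows
  when \<open>k\<close> is added, so it is at most \<open>fact (k + j) / fact (k + j - i)\<close>.
  The latter is at least 1, hence at most its own power with exponent \<open>s\<close>. This absorbs
  the factorials of the Leibniz rule into Gevrey bounds of order \<open>s\<close>.\<close>

lemma fact_powr_ratio_le:
  assumes "s \<ge> 1" "i \<le> j"
  shows "fact j / fact (j - i) * fact (k + j - i) powr s \<le> (fact (k + j) powr s :: real)"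
proof -
  have "fact j * fact (k + j - i) \<le> (fact (k + j) * fact (j - i) :: nat)"
  proof (induction k)
    case (Suc k)
    have "fact j * fact (Suc k + j - i) = (Suc k + j - i) * (fact j * fact (k + j - i) :: nat)"
      using assms(2) by (simp add: Suc_diff_le algebra_simps)
    also have "\<dots> \<le> (Suc k + j) * (fact (k + j) * fact (j - i))"
      by (intro mult_mono Suc.IH) auto
    finally show ?case by (simp add: algebra_simps)
  qed simp
  then have "real (fact j * fact (k + j - i)) \<le> real (fact (k + j) * fact (j - i))"
    by (simp only: of_nat_le_iff)
  then have le: "fact j / fact (j - i) \<le> (fact (k + j) / fact (k + j - i) :: real)"
    by (simp add: field_simps)
  have ge: "1 \<le> (fact (k + j) / fact (k + j - i) :: real)"
    by (simp add: fact_mono)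
  have "fact (k + j) / fact (k + j - i) \<le> (fact (k + j) / fact (k + j - i) :: real) powr s"
    using powr_mono[of 1 s "fact (k + j) / fact (k + j - i)"] ge assms by simp
  with le have "fact j / fact (j - i) \<le> (fact (k + j) / fact (k + j - i) :: real) powr s" by linarith
  then have "fact j / fact (j - i) * fact (k + j - i) powr s \<le>
      (fact (k + j) / fact (k + j - i) :: real) powr s * fact (k + j - i) powr s"
    by (rule mult_right_mono) simp
  then show ?thesis by (simp flip: powr_mult)
qed

text \<open>The growth of \<open>b\<close> is analytic with radius \<open>1 / \<rho>\<close>, that
  of \<open>f\<close> is Gevrey of order \<open>s\<close>. In the Leibniz sum the term with
  \<open>i\<close> derivatives on \<open>b\<close> is at most \<open>(1 / 2) ^ i\<close> times a
  common bound, because \<open>\<rho>\<close> is at most \<open>H / 2\<close>; the geometric sum is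
  the 2 in \<open>2 * B\<close>. The estimate is pointwise, so \<open>A\<close> may later depend on
  \<open>x\<close>.\<close>

lemma ibp_bound:
  fixes s H \<rho> A B :: real
  assumes s: "s \<ge> 1" and H: "H > 0" "0 \<le> \<rho>" "\<rho> \<le> H / 2" and AB: "A \<ge> 0" "B \<ge> 0"
    and f: "\<And>n. cmod (f n x) \<le> A * H ^ n * fact n powr s"
    and b: "\<And>n. cmod (b n x) \<le> B * \<rho> ^ n * fact n"
  shows "cmod (ibp b f k j x) \<le> A * (2 * B) ^ k * H ^ (k + j) * fact (k + j) powr s"
proof (induction k arbitrary: j)
  case 0
  then show ?case using f by simp
next
  case (Suc k)
  define n where "n = Suc j"
  define M where "M = A * (2 * B) ^ k * B * H ^ (k + n) * fact (k + n) powr s"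
  have M: "M \<ge> 0" using AB H by (simp add: M_def)
  have "cmod (leibniz (ibp b f k) b n x) \<le>
      (\<Sum>i\<le>n. real (n choose i) * (A * (2 * B) ^ k * H ^ (k + (n - i)) * fact (k + (n - i)) powr s)
          * (B * \<rho> ^ i * fact i))"
    unfolding leibniz_def
  proof (rule sum_norm_le)
    fix i
    show "cmod (of_nat (n choose i) * ibp b f k (n - i) x * b i x) \<le>
      real (n choose i) * (A * (2 * B) ^ k * H ^ (k + (n - i)) * fact (k + (n - i)) powr s)
          * (B * \<rho> ^ i * fact i)"
      unfolding norm_mult by (intro mult_mono Suc.IH b) (use AB H in auto)
  qed
  also have "\<dots> \<le> (\<Sum>i\<le>n. M * (1 / 2) ^ i)"
  proof (rule sum_mono)
    fix i assume "i \<in> {..n}"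
    then have i: "i \<le> n" by simp
    have "real (n choose i) * (A * (2 * B) ^ k * H ^ (k + (n - i)) * fact (k + (n - i)) powr s)
          * (B * \<rho> ^ i * fact i) =
        A * (2 * B) ^ k * B * H ^ (k + (n - i)) * (fact n / fact (n - i) * fact (k + n - i) powr s) * \<rho> ^ i"
      using i by (simp add: binomial_fact field_simps)
    also have "\<dots> \<le> A * (2 * B) ^ k * B * H ^ (k + (n - i)) * fact (k + n) powr s * (H / 2) ^ i"
      by (intro mult_mono power_mono fact_powr_ratio_le mult_left_mono) (use AB H i s in auto)
    also have "\<dots> = A * (2 * B) ^ k * B * (H ^ (k + (n - i)) * H ^ i) * fact (k + n) powr s * (1 / 2) ^ i"
      by (simp add: power_divide)
    also have "H ^ (k + (n - i)) * H ^ i = H ^ (k + n)"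
      using i by (simp flip: power_add)
    finally show "real (n choose i) * (A * (2 * B) ^ k * H ^ (k + (n - i)) * fact (k + (n - i)) powr s)
          * (B * \<rho> ^ i * fact i) \<le> M * (1 / 2) ^ i"
      by (simp add: M_def)
  qed
  also have "\<dots> = M * (\<Sum>i\<le>n. (1 / 2) ^ i)" by (simp add: sum_distrib_left)
  also have "\<dots> \<le> M * 2"
    by (rule mult_left_mono[OF _ M]) (subst sum_gp0, auto)
  finally show ?case by (simp add: n_def M_def mult_ac)
qed

text \<open>As \<open>b 0\<close> is the reciprocal of \<open>\<Phi>'\<close>, the function
  \<open>exp \<Phi>\<close> equals \<open>b 0\<close> times its own derivative. Each integration by
  parts therefore applies \<open>L\<close> once more to \<open>f\<close>, at the price of one pair
  of boundary terms.\<close>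

lemma has_integral_ibp:
  fixes \<Phi> \<Phi>' :: "real \<Rightarrow> complex"
  assumes pq: "p \<le> q"
    and \<Phi>: "\<And>y. y \<in> {p..q} \<Longrightarrow> (\<Phi> has_vector_derivative \<Phi>' y) (at y within {p..q})"
    and b0: "\<And>y. y \<in> {p..q} \<Longrightarrow> \<Phi>' y * b 0 y = 1"
    and f: "\<And>n y. y \<in> {p..q} \<Longrightarrow> (f n has_vector_derivative f (Suc n) y) (at y within {p..q})"
    and b: "\<And>n y. y \<in> {p..q} \<Longrightarrow> (b n has_vector_derivative b (Suc n) y) (at y within {p..q})"
  shows "integral {p..q} (\<lambda>y. exp (\<Phi> y) * f 0 y) =
    (\<Sum>k<N. exp (\<Phi> q) * ibp b f k 0 q * b 0 q - exp (\<Phi> p) * ibp b f k 0 p * b 0 p)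
    + integral {p..q} (\<lambda>y. exp (\<Phi> y) * ibp b f N 0 y)"
proof (induction N)
  case (Suc N)
  define g where "g = ibp b f N 0"
  \<comment> \<open>\<open>E\<close> is an antiderivative of the difference of two consecutive
    integrands, so the step is one use of the fundamental theorem of calculus.\<close>
  define E where "E y = exp (\<Phi> y) * (g y * b 0 y)" for y
  have d: "(ibp b f k j has_vector_derivative ibp b f k (Suc j) y) (at y within {p..q})"
    if "y \<in> {p..q}" for k j y
    using that by (intro has_vector_derivative_ibp f b)
  have e: "((\<lambda>y. exp (\<Phi> y)) has_vector_derivative exp (\<Phi> y) * \<Phi>' y) (at y within {p..q})"
    if "y \<in> {p..q}" for y
    using field_vector_diff_chain_within[OF \<Phi>[OF that], of exp "exp (\<Phi> y)"]
    by (simp add: o_def mult.commute DERIV_exp has_field_derivative_at_within)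
  have cont: "continuous_on {p..q} (\<lambda>y. exp (\<Phi> y) * ibp b f k 0 y)" for k
    by (intro continuous_on_mult continuous_on_vector_derivative[OF e] continuous_on_vector_derivative[OF d])
  have "((\<lambda>y. exp (\<Phi> y) * g y - exp (\<Phi> y) * ibp b f (Suc N) 0 y) has_integral E q - E p) {p..q}"
  proof (rule fundamental_theorem_of_calculus[OF pq])
    fix y assume y: "y \<in> {p..q}"
    have "(E has_vector_derivative exp (\<Phi> y) * (g y * b 1 y + ibp b f N 1 y * b 0 y)
        + exp (\<Phi> y) * \<Phi>' y * (g y * b 0 y)) (at y within {p..q})"
      unfolding E_def g_def using d[OF y, of N 0] b[OF y, of 0]
      by (auto intro!: has_vector_derivative_mult e y)
    also have "exp (\<Phi> y) * (g y * b 1 y + ibp b f N 1 y * b 0 y) + exp (\<Phi> y) * \<Phi>' y * (g y * b 0 y)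
      = exp (\<Phi> y) * (\<Phi>' y * b 0 y) * g y + exp (\<Phi> y) * (g y * b 1 y + ibp b f N 1 y * b 0 y)"
      by (simp add: algebra_simps)
    also have "\<dots> = exp (\<Phi> y) * g y - exp (\<Phi> y) * ibp b f (Suc N) 0 y"
      using b0[OF y] by (simp add: leibniz_def g_def algebra_simps)
    finally show "(E has_vector_derivative exp (\<Phi> y) * g y - exp (\<Phi> y) * ibp b f (Suc N) 0 y)
       (at y within {p..q})" .
  qed
  then have "integral {p..q} (\<lambda>y. exp (\<Phi> y) * g y - exp (\<Phi> y) * ibp b f (Suc N) 0 y) = E q - E p"
    by (rule integral_unique)
  also have "integral {p..q} (\<lambda>y. exp (\<Phi> y) * g y - exp (\<Phi> y) * ibp b f (Suc N) 0 y) =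
      integral {p..q} (\<lambda>y. exp (\<Phi> y) * g y) - integral {p..q} (\<lambda>y. exp (\<Phi> y) * ibp b f (Suc N) 0 y)"
    unfolding g_def
    by (rule Henstock_Kurzweil_Integration.integral_diff) (intro integrable_continuous_real cont)+
  finally have "integral {p..q} (\<lambda>y. exp (\<Phi> y) * g y) =
      E q - E p + integral {p..q} (\<lambda>y. exp (\<Phi> y) * ibp b f (Suc N) 0 y)"
    by (simp add: algebra_simps)
  with Suc.IH show ?case by (simp add: E_def g_def mult.assoc)
qed simp

section \<open>Exponential decay of Gelfand--Shilov functions\<close>

lemma GS_seminorm_deriv_boundD:
  assumes "GS_seminorm t s h g \<le> ennreal N" "h > 0" "N \<ge> 0"
  shows "\<bar>x\<bar> ^ k * cmod (nth_vderiv n g x) \<le> N * h ^ (k + n) * fact k powr t * fact n powr s"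
proof -
  have "ennreal (cmod (of_real (x ^ k) * D_op n g x)
                 / (h ^ (k + n) * fact k powr t * fact n powr s)) \<le> GS_seminorm t s h g"
    unfolding GS_seminorm_def by (rule SUP_upper2[where i = "(k, n, x)"]) auto
  also have "\<dots> \<le> ennreal N" by fact
  finally have "cmod (of_real (x ^ k) * D_op n g x) / (h ^ (k + n) * fact k powr t * fact n powr s) \<le> N"
    using assms by (simp add: ennreal_le_iff)
  then show ?thesis
    using assms by (simp add: D_op_def divide_le_eq norm_mult norm_power mult_ac)
qed

text \<open>Raised to the power \<open>1 / t\<close>, the bound with weight
  \<open>\<bar>x\<bar> ^ k\<close> has \<open>fact k\<close> in place of
  \<open>fact k powr t\<close>. Dividing by it and summing over \<open>k\<close> produces an
  exponential series in \<open>\<bar>x\<bar> powr (1 / t)\<close>.\<close>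

lemma GS_deriv_decay:
  assumes \<psi>: "\<psi> \<in> GS_space t s" and t: "t > 0" and a: "a > 0" and h: "h > 0"
  obtains C where "C \<ge> 0"
    "\<And>n x. cmod (nth_vderiv n \<psi> x) \<le> C * h ^ n * fact n powr s * exp (- a * \<bar>x\<bar> powr (1 / t))"
proof
  \<comment> \<open>The first entry preserves the factor \<open>h ^ n\<close>; the second makes
    \<open>t * q / 2\<close> below at least \<open>a * \<bar>x\<bar> powr (1 / t)\<close>.\<close>
  define h' where "h' = min h ((t / (2 * a)) powr t)"
  have h': "h' > 0" "h' \<le> h" "h' \<le> (t / (2 * a)) powr t" using t a h by (auto simp: h'_def)
  define N where "N = enn2real (GS_seminorm t s h' \<psi>)"
  have N0: "N \<ge> 0" by (simp add: N_def)
  have N: "GS_seminorm t s h' \<psi> \<le> ennreal N"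
    using \<psi> h' by (auto simp: GS_space_def N_def)
  show "2 powr t * N \<ge> 0" using N0 by simp
  fix n x
  define q where "q = (\<bar>x\<bar> / h') powr (1 / t)"
  define M where "M = cmod (nth_vderiv n \<psi> x)"
  define A where "A = N * h' ^ n * fact n powr s"
  have A: "A \<ge> 0" and M: "M \<ge> 0" using N0 h' by (auto simp: A_def M_def)
  \<comment> \<open>Halving \<open>q\<close> leaves a convergent geometric series on the
    right.\<close>
  have "(q / 2) ^ k /\<^sub>R fact k * M powr (1 / t) \<le> A powr (1 / t) * (1 / 2) ^ k" for k
  proof -
    have "\<bar>x\<bar> ^ k * M \<le> A * h' ^ k * fact k powr t"
      using GS_seminorm_deriv_boundD[OF N h'(1) N0, of x k n] by (simp add: A_def M_def power_add mult_ac)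
    then have "(\<bar>x\<bar> / h') ^ k * M \<le> A * fact k powr t"
      using h' by (simp add: power_divide divide_le_eq mult_ac)
    then have "((\<bar>x\<bar> / h') ^ k * M) powr (1 / t) \<le> (A * fact k powr t) powr (1 / t)"
      using t M h' by (intro powr_mono2) auto
    moreover have "((\<bar>x\<bar> / h') ^ k) powr (1 / t) = q ^ k"
    proof (cases "x = 0")
      case True then show ?thesis using t by (cases k) (auto simp: q_def)
    next
      case False
      then show ?thesis using h' unfolding q_def
        by (simp flip: powr_realpow add: powr_powr mult.commute)
    qed
    ultimately have "q ^ k * M powr (1 / t) \<le> A powr (1 / t) * fact k"
      using t A M h' by (simp add: powr_mult powr_powr)
    then show ?thesis by (simp add: field_simps power_divide)
  qed
  moreover have "(\<lambda>k. (q / 2) ^ k /\<^sub>R fact k * M powr (1 / t)) sums (exp (q / 2) * M powr (1 / t))"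
    by (intro sums_mult2 exp_converges)
  moreover have "(\<lambda>k. A powr (1 / t) * (1 / 2) ^ k) sums (A powr (1 / t) * 2)"
    using sums_mult[OF geometric_sums[of "1/2::real"], of "A powr (1 / t)"] by simp
  ultimately have "exp (q / 2) * M powr (1 / t) \<le> A powr (1 / t) * 2"
    by (rule sums_le)
  then have "(exp (q / 2) * M powr (1 / t)) powr t \<le> (A powr (1 / t) * 2) powr t"
    using t by (intro powr_mono2) auto
  then have le: "exp (t * q / 2) * M \<le> 2 powr t * A"
    using t A M by (simp add: powr_mult powr_powr powr_def[of "exp _"] mult_ac)
  have "a * \<bar>x\<bar> powr (1 / t) \<le> t * q / 2"
  proof -
    have "h' powr (1 / t) \<le> ((t / (2 * a)) powr t) powr (1 / t)"
      using t h' by (intro powr_mono2) auto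
    also have "\<dots> = t / (2 * a)" using t a by (simp add: powr_powr)
    finally have "a * h' powr (1 / t) \<le> t / 2" using a by (simp add: field_simps)
    then have "a * h' powr (1 / t) * \<bar>x\<bar> powr (1 / t) \<le> t / 2 * \<bar>x\<bar> powr (1 / t)"
      by (rule mult_right_mono) simp
    moreover have "0 < h' powr (1 / t)" using h' by simp
    ultimately show ?thesis
      using h' by (simp add: q_def powr_divide field_simps)
  qed
  then have "exp (a * \<bar>x\<bar> powr (1 / t)) * M \<le> exp (t * q / 2) * M"
    using M by (intro mult_right_mono) auto
  also have "\<dots> \<le> 2 powr t * A" by (rule le)
  also have "\<dots> \<le> 2 powr t * (N * h ^ n * fact n powr s)"
    unfolding A_def using N0 h' by (intro mult_left_mono mult_right_mono power_mono) auto
  finally show "cmod (nth_vderiv n \<psi> x) \<le> 2 powr t * N * h ^ n * fact n powr s * exp (- a * \<bar>x\<bar> powr (1 / t))"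
    by (simp add: M_def exp_minus field_simps)
qed

lemma le_one_plus_powr:
  fixes x p :: real
  assumes "x \<ge> 0" "p \<ge> 1"
  shows "x \<le> 1 + x powr p"
proof (cases "x \<le> 1")
  case False
  then have "x powr 1 \<le> x powr p" using assms by (intro powr_mono) auto
  then show ?thesis using False by simp
qed (use powr_ge_zero[of x p] in linarith)

text \<open>Since \<open>1 / t\<close> is at least 1, \<open>\<bar>x\<bar>\<close> is at most
  \<open>1 + \<bar>x\<bar> powr (1 / t)\<close>, so decay at rate \<open>a + b + 1\<close> in the
  power pays for the weight and for an extra \<open>exp (- \<bar>x\<bar>)\<close>. The weight serves
  against the growth of \<open>exp (z * y)\<close>, the extra factor gives integrability.\<close>

lemma GS_deriv_weighted_decay:
  assumes \<psi>: "\<psi> \<in> GS_space t s" and t: "0 < t" "t \<le> 1" and ab: "a \<ge> 0" "b \<ge> 0" and h: "h > 0"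
  obtains C where "C \<ge> 0"
    "\<And>n x. exp (b * \<bar>x\<bar>) * cmod (nth_vderiv n \<psi> x) \<le>
       C * exp (- \<bar>x\<bar>) * exp (- a * \<bar>x\<bar> powr (1 / t)) * h ^ n * fact n powr s"
proof -
  obtain C where C: "C \<ge> 0" "\<And>n x. cmod (nth_vderiv n \<psi> x) \<le>
      C * h ^ n * fact n powr s * exp (- (a + b + 1) * \<bar>x\<bar> powr (1 / t))"
    using GS_deriv_decay[OF \<psi> t(1) _ h, of "a + b + 1"] ab by auto
  show ?thesis
  proof (rule that[of "C * exp (b + 1)"])
    fix n x
    define w where "w = \<bar>x\<bar> powr (1 / t)"
    have "\<bar>x\<bar> \<le> 1 + w" unfolding w_def using t by (intro le_one_plus_powr) auto
    then have "(b + 1) * \<bar>x\<bar> \<le> (b + 1) * (1 + w)"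
      using ab by (intro mult_left_mono) auto
    then have e: "b * \<bar>x\<bar> + - (a + b + 1) * w \<le> b + 1 + (- \<bar>x\<bar> + - a * w)"
      by (simp add: algebra_simps)
    have "exp (b * \<bar>x\<bar>) * cmod (nth_vderiv n \<psi> x) \<le>
       exp (b * \<bar>x\<bar>) * (C * h ^ n * fact n powr s * exp (- (a + b + 1) * w))"
      unfolding w_def by (intro mult_left_mono C) auto
    also have "\<dots> = C * h ^ n * fact n powr s * exp (b * \<bar>x\<bar> + - (a + b + 1) * w)"
      by (simp add: exp_add mult_ac)
    also have "\<dots> \<le> C * h ^ n * fact n powr s * exp (b + 1 + (- \<bar>x\<bar> + - a * w))"
      using e C h by (intro mult_left_mono) auto
    finally show "exp (b * \<bar>x\<bar>) * cmod (nth_vderiv n \<psi> x) \<le>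
       C * exp (b + 1) * exp (- \<bar>x\<bar>) * exp (- a * \<bar>x\<bar> powr (1 / t)) * h ^ n * fact n powr s"
      unfolding exp_add by (simp add: w_def mult_ac)
  qed (use C in auto)
qed

section \<open>Decay off the curve of stationary points\<close>

text \<open>The argument is complex because the derivatives of \<open>1 / phase'\<close> at real
  points are estimated by Cauchy's inequalities on complex discs. With \<open>z * y\<close> in the
  phase, \<open>phase'\<close> differs from a homogeneous expression only by the constant
  \<open>z\<close>.\<close>

definition phase :: "complex \<Rightarrow> real \<Rightarrow> nat \<Rightarrow> real \<Rightarrow> complex \<Rightarrow> complex" where
  "phase z c m \<xi> y = z * y + \<i> * of_real c * y ^ m - \<i> * of_real \<xi> * y"

definition phase' :: "complex \<Rightarrow> real \<Rightarrow> nat \<Rightarrow> real \<Rightarrow> complex \<Rightarrow> complex" where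
  "phase' z c m \<xi> y = z + \<i> * of_real c * (of_nat m * y ^ (m - 1)) - \<i> * of_real \<xi>"

lemma has_field_derivative_phase:
  "(phase z c m \<xi> has_field_derivative phase' z c m \<xi> y) (at y within S)"
  unfolding phase_def[abs_def] phase'_def by (auto intro!: derivative_eq_intros)

lemma Re_phase_of_real [simp]: "Re (phase z c m \<xi> (of_real y)) = Re z * y"
  by (simp add: phase_def flip: of_real_power of_real_mult)

lemma continuous_phase: "continuous_on S (\<lambda>y. exp (phase z c m \<xi> (of_real y)))"
  unfolding phase_def by (intro continuous_intros)

lemma smooth_has_vector_derivative:
  assumes "smooth \<psi>"
  shows "(nth_vderiv n \<psi> has_vector_derivative nth_vderiv (Suc n) \<psi> x) (at x)"
  using assms by (simp add: smooth_def nth_vderiv_def vector_derivative_works)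

lemma smooth_cnj_shift:
  assumes "smooth \<psi>"
  shows "((\<lambda>y. cnj (nth_vderiv n \<psi> (y - a))) has_vector_derivative cnj (nth_vderiv (Suc n) \<psi> (y - a)))
    (at y within S)"
proof -
  have "((\<lambda>y. y - a) has_vector_derivative 1) (at y)"
    by (auto intro!: derivative_eq_intros)
  then have "((\<lambda>y. nth_vderiv n \<psi> (y - a)) has_vector_derivative nth_vderiv (Suc n) \<psi> (y - a)) (at y)"
    using vector_diff_chain_at[OF _ smooth_has_vector_derivative[OF assms], of "\<lambda>y. y - a" 1 y n]
    by (auto simp: o_def)
  then show ?thesis
    by (intro has_vector_derivative_cnj) (rule has_vector_derivative_at_within)
qed

text \<open>Separates the growth at the centre \<open>x\<close> of the window from the growth
  relative to it, which the decay of the window absorbs.\<close>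

lemma exp_Re_le: "exp (Re z * y) \<le> exp (cmod z * \<bar>x\<bar>) * exp (cmod z * \<bar>y - x\<bar>)" for x y :: real
proof -
  have "Re z * y \<le> \<bar>Re z\<bar> * \<bar>y\<bar>" by (simp flip: abs_mult)
  also have "\<dots> \<le> cmod z * (\<bar>x\<bar> + \<bar>y - x\<bar>)" by (intro mult_mono abs_Re_le_cmod) auto
  finally show ?thesis by (simp flip: exp_add add: distrib_left)
qed

text \<open>\<open>N\<close> integrations by parts with \<open>b = 1 / phase'\<close>, which is
  bounded by \<open>B\<close> on the disc of radius \<open>2 * R\<close> about \<open>X\<close>.
  That disc contains the disc of radius \<open>R\<close> about every point of the interval, so
  Cauchy's inequalities give derivatives of size \<open>B * (1 / R) ^ n * fact n\<close>. In the
  conclusion the sum collects the boundary terms, at distance \<open>R\<close> from the centre; the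
  last summand is the remaining integral over length \<open>2 * R\<close>.\<close>

lemma nonstationary_integral_bound:
  fixes \<psi> :: "real \<Rightarrow> complex" and a s t B C H R X \<xi> :: real
  defines "A \<equiv> \<lambda>w. C * exp (- \<bar>w\<bar>) * exp (- a * \<bar>w\<bar> powr (1 / t))"
  assumes \<psi>: "smooth \<psi>" and a: "a \<ge> 0" and s: "s \<ge> 1" and R: "R > 0" "1 / R \<le> H / 2"
    and B: "B > 0" "\<And>y. cmod (y - of_real X) \<le> 2 * R \<Longrightarrow> 1 \<le> B * cmod (phase' z c m \<xi> y)"
    and C: "C \<ge> 0" "\<And>n w. exp (cmod z * \<bar>w\<bar>) * cmod (nth_vderiv n \<psi> w) \<le> A w * H ^ n * fact n powr s"
  shows "cmod (integral {X - R..X + R} (\<lambda>y. exp (phase z c m \<xi> (of_real y)) * cnj (\<psi> (y - X)))) \<le>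
    exp (cmod z * \<bar>X\<bar>) * C *
     (2 * B * exp (- a * R powr (1 / t)) * (\<Sum>k<N. (2 * B * H) ^ k * fact k powr s)
      + 2 * R * ((2 * B * H) ^ N * fact N powr s))"
proof -
  define S where "S = {y. phase' z c m \<xi> y \<noteq> 0}"
  define g where "g y = 1 / phase' z c m \<xi> y" for y
  define b where "b n y = (deriv ^^ n) g (of_real y)" for n and y :: real
  define f where "f n y = cnj (nth_vderiv n \<psi> (y - X))" for n y
  define I where "I = {X - R..X + R}"
  define K where "K = exp (cmod z * \<bar>X\<bar>)"
  have H: "H > 0" 
  proof -
    have "0 < 1 / R" using R by simp
    then show ?thesis using R(2) by linarith
  qed
  have A0: "A w \<ge> 0" for w using C by (simp add: A_def)
  have "continuous_on UNIV (phase' z c m \<xi>)" unfolding phase'_def by (intro continuous_intros)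
  then have S: "open S" unfolding S_def by (intro open_Collect_neq) auto
  have hol: "g holomorphic_on S"
    unfolding g_def S_def phase'_def by (intro holomorphic_intros) auto
  have inS: "y \<in> S" and g_le: "cmod (g y) \<le> B" if "cmod (y - of_real X) \<le> 2 * R" for y
  proof -
    show "y \<in> S" using B(2)[OF that] by (auto simp: S_def)
    then show "cmod (g y) \<le> B"
      using B(2)[OF that] by (simp add: g_def norm_divide divide_le_eq S_def)
  qed
  have near: "cmod (w - of_real X) \<le> 2 * R" if "y \<in> I" "dist (of_real y) w \<le> R" for y w
  proof -
    have "cmod (w - of_real X) \<le> cmod (of_real y - w) + cmod (of_real y - of_real X)"
      using norm_triangle_ineq[of "w - of_real y" "of_real y - of_real X"] by (simp add: norm_minus_commute)
    also have "cmod (of_real y - of_real X) \<le> R" using that by (auto simp: I_def simp flip: of_real_diff)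
    finally show ?thesis using that by (simp add: dist_norm)
  qed
  have bd: "(b n has_vector_derivative b (Suc n) y) (at y within T)" if "y \<in> I" for n y T
  proof -
    have "of_real y \<in> S" by (intro inS near[OF that]) (use R in simp)
    then have "((deriv ^^ n) g has_field_derivative (deriv ^^ Suc n) g (of_real y)) (at (of_real y))"
      by (intro has_field_derivative_higher_deriv[OF hol S])
    then show ?thesis unfolding b_def by (rule has_vector_derivative_real_field)
  qed
  have b_le: "cmod (b n y) \<le> B * (1 / R) ^ n * fact n" if y: "y \<in> I" for n y
  proof -
    have sub: "cball (of_real y) R \<subseteq> S"
      using near[OF y] inS by auto
    have "cmod ((deriv ^^ n) g (of_real y)) \<le> fact n * B / R ^ n"
    proof (rule Cauchy_inequality)
      show "g holomorphic_on ball (of_real y) R"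
        by (rule holomorphic_on_subset[OF hol]) (use sub in auto)
      show "continuous_on (cball (of_real y) R) g"
        by (rule holomorphic_on_imp_continuous_on[OF holomorphic_on_subset[OF hol sub]])
      show "cmod (g w) \<le> B" if "cmod (of_real y - w) = R" for w
        by (intro g_le near[OF y]) (use that in \<open>simp add: dist_norm\<close>)
    qed fact
    then show ?thesis by (simp add: b_def power_divide mult_ac)
  qed
  have fd: "(f n has_vector_derivative f (Suc n) y) (at y within T)" for n y T
    unfolding f_def by (rule smooth_cnj_shift[OF \<psi>])
  have ibp_le: "exp (Re z * y) * cmod (ibp b f k 0 y) \<le> K * A (y - X) * ((2 * B * H) ^ k * fact k powr s)"
    if y: "y \<in> I" for k y
  proof -
    \<comment> \<open>\<open>ibp_bound\<close> concerns the window without its weight, so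
      \<open>D\<close> is divided out of \<open>A\<close>; it returns as the growth of
      \<open>exp (Re z * y)\<close> relative to the centre.\<close>
    define D where "D = exp (cmod z * \<bar>y - X\<bar>)"
    have D: "D > 0" by (simp add: D_def)
    have "cmod (ibp b f k 0 y) \<le> (A (y - X) / D) * (2 * B) ^ k * H ^ (k + 0) * fact (k + 0) powr s"
    proof (rule ibp_bound[where \<rho> = "1 / R"])
      show "cmod (b n y) \<le> B * (1 / R) ^ n * fact n" for n by (rule b_le[OF y])
      show "cmod (f n y) \<le> A (y - X) / D * H ^ n * fact n powr s" for n
        using C(2)[of "y - X" n] D by (simp add: f_def D_def field_simps)
    qed (use R B A0 D s H in auto)
    then have "D * cmod (ibp b f k 0 y) \<le> A (y - X) * ((2 * B * H) ^ k * fact k powr s)"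
      using D by (simp add: field_simps power_mult_distrib)
    then have "K * (D * cmod (ibp b f k 0 y)) \<le> K * (A (y - X) * ((2 * B * H) ^ k * fact k powr s))"
      by (rule mult_left_mono) (simp add: K_def)
    moreover have "exp (Re z * y) * cmod (ibp b f k 0 y) \<le> K * D * cmod (ibp b f k 0 y)"
      unfolding K_def D_def by (intro mult_right_mono exp_Re_le) auto
    ultimately show ?thesis by (simp add: mult.assoc)
  qed
  have A_le: "A w \<le> C" for w
  proof -
    have "C * exp (- \<bar>w\<bar>) * exp (- a * \<bar>w\<bar> powr (1 / t)) \<le> C * 1 * 1"
      using C a by (intro mult_mono) auto
    then show ?thesis by (simp add: A_def)
  qed
  have A_R: "A w \<le> C * exp (- a * R powr (1 / t))" if "\<bar>w\<bar> = R" for w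
  proof -
    have "C * exp (- \<bar>w\<bar>) * exp (- a * \<bar>w\<bar> powr (1 / t)) \<le> C * 1 * exp (- a * \<bar>w\<bar> powr (1 / t))"
      using C by (intro mult_mono) auto
    then show ?thesis using that by (simp add: A_def)
  qed
  define T where "T k = (2 * B * H) ^ k * fact k powr s" for k
  have T: "T k \<ge> 0" for k using B H by (simp add: T_def)
  have bdry: "cmod (exp (phase z c m \<xi> (of_real y)) * ibp b f k 0 y * b 0 y) \<le>
      K * C * exp (- a * R powr (1 / t)) * T k * B"
    if y: "y \<in> I" "\<bar>y - X\<bar> = R" for y k
  proof -
    have "exp (Re z * y) * cmod (ibp b f k 0 y) * cmod (b 0 y) \<le>
        (K * A (y - X) * T k) * B"
      unfolding T_def using b_le[OF y(1), of 0] B A0 H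
      by (intro mult_mono ibp_le y) (auto simp: K_def)
    also have "\<dots> \<le> (K * (C * exp (- a * R powr (1 / t))) * T k) * B"
      using T B by (intro mult_right_mono mult_left_mono A_R y) (auto simp: K_def)
    finally show ?thesis by (simp add: norm_mult mult.assoc)
  qed
  have "(ibp b f N 0 has_vector_derivative ibp b f N (Suc 0) y) (at y within I)" if "y \<in> I" for y
    by (rule has_vector_derivative_ibp) (rule fd bd[OF that])+
  then have "continuous_on I (ibp b f N 0)"
    by (rule continuous_on_vector_derivative)
  then have cont: "continuous_on I (\<lambda>y. exp (phase z c m \<xi> (of_real y)) * ibp b f N 0 y)"
    by (intro continuous_on_mult continuous_phase)
  have inner: "cmod (integral I (\<lambda>y. exp (phase z c m \<xi> (of_real y)) * ibp b f N 0 y)) \<le>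
      K * C * T N * (X + R - (X - R))"
    unfolding I_def
  proof (rule integral_bound)
    show "cmod (exp (phase z c m \<xi> (of_real y)) * ibp b f N 0 y) \<le> K * C * T N"
      if "y \<in> {X - R..X + R}" for y
    proof -
      have "exp (Re z * y) * cmod (ibp b f N 0 y) \<le> K * A (y - X) * T N"
        unfolding T_def by (rule ibp_le) (use that in \<open>simp add: I_def\<close>)
      also have "\<dots> \<le> K * C * T N"
        using T by (intro mult_right_mono mult_left_mono A_le) (auto simp: K_def)
      finally show ?thesis by (simp add: norm_mult mult.assoc)
    qed
  qed (use R cont in \<open>auto simp: I_def\<close>)
  have eq: "integral I (\<lambda>y. exp (phase z c m \<xi> (of_real y)) * f 0 y) =
    (\<Sum>k<N. exp (phase z c m \<xi> (of_real (X + R))) * ibp b f k 0 (X + R) * b 0 (X + R)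
       - exp (phase z c m \<xi> (of_real (X - R))) * ibp b f k 0 (X - R) * b 0 (X - R))
    + integral I (\<lambda>y. exp (phase z c m \<xi> (of_real y)) * ibp b f N 0 y)"
    unfolding I_def
  proof (rule has_integral_ibp[where \<Phi>' = "\<lambda>y. phase' z c m \<xi> (of_real y)"])
    fix y assume "y \<in> {X - R..X + R}"
    then have y: "y \<in> I" by (simp add: I_def)
    then show "(b n has_vector_derivative b (Suc n) y) (at y within {X - R..X + R})" for n by (rule bd)
    show "((\<lambda>y. phase z c m \<xi> (of_real y)) has_vector_derivative phase' z c m \<xi> (of_real y))
        (at y within {X - R..X + R})"
      by (rule has_vector_derivative_real_field[OF has_field_derivative_phase])
    have "of_real y \<in> S" by (intro inS near[OF y]) (use R in simp)
    then show "phase' z c m \<xi> (of_real y) * b 0 y = 1" by (simp add: b_def g_def S_def)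
  qed (use R in \<open>auto intro: fd\<close>)
  have "cmod (integral I (\<lambda>y. exp (phase z c m \<xi> (of_real y)) * f 0 y)) \<le> (\<Sum>k<N. 2 * (K * C * exp (- a * R powr (1 / t)) * T k * B)) + K * C * T N * (X + R - (X - R))"
    unfolding eq
  proof (intro norm_triangle_mono inner sum_norm_le)
    fix k
    show "cmod (exp (phase z c m \<xi> (of_real (X + R))) * ibp b f k 0 (X + R) * b 0 (X + R)
       - exp (phase z c m \<xi> (of_real (X - R))) * ibp b f k 0 (X - R) * b 0 (X - R)) \<le>
       2 * (K * C * exp (- a * R powr (1 / t)) * T k * B)"
      using R bdry[of "X + R" k] bdry[of "X - R" k]
      by (intro order_trans[OF norm_triangle_ineq4]) (auto simp: I_def)
  qed
  also have "\<dots> = K * C * (2 * B * exp (- a * R powr (1 / t)) * (\<Sum>k<N. T k) + 2 * R * T N)"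
  proof -
    have *: "(\<Sum>k<N. 2 * (K * C * e * T k * B)) = K * C * (2 * B * e) * (\<Sum>k<N. T k)" for e
      unfolding sum_distrib_left by (rule sum.cong[OF refl]) (simp only: mult_ac)
    show ?thesis unfolding * by (simp add: distrib_left)
  qed
  finally show ?thesis
    by (simp add: f_def I_def K_def T_def nth_vderiv_def)
qed

section \<open>The short-time Fourier transform as an oscillatory integral\<close>

definition osc :: "complex \<Rightarrow> real \<Rightarrow> nat \<Rightarrow> (real \<Rightarrow> complex) \<Rightarrow> real \<Rightarrow> real \<Rightarrow> real \<Rightarrow> complex" where
  "osc z c m \<psi> X \<xi> y = exp (phase z c m \<xi> (of_real y)) * cnj (\<psi> (y - X))"

lemma STFT_eq_osc:
  "STFT \<psi> (functional_of (\<lambda>x. exp (z * of_real x + \<i> * of_real c * of_real x ^ m))) X \<xi> =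
     of_real ((2 * pi) powr (- 1 / 2)) * (LINT y|lborel. osc z c m \<psi> X \<xi> y)"
proof -
  have "exp (z * of_real y + \<i> * of_real c * of_real y ^ m) * cnj (modulation \<xi> (translation X \<psi>) y)
      = osc z c m \<psi> X \<xi> y" for y
    by (simp add: osc_def modulation_def translation_def phase_def exp_diff exp_minus exp_cnj
        divide_inverse mult_ac)
  then show ?thesis by (simp add: STFT_def functional_of_def)
qed

lemma continuous_osc:
  assumes "continuous_on UNIV \<psi>"
  shows "continuous_on UNIV (osc z c m \<psi> X \<xi>)"
  unfolding osc_def[abs_def]
  by (intro continuous_on_mult continuous_phase continuous_on_cnj continuous_on_compose2[OF assms])
     (auto intro!: continuous_intros)

lemma osc_borel [measurable]:
  "continuous_on UNIV \<psi> \<Longrightarrow> osc z c m \<psi> X \<xi> \<in> borel_measurable borel"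
  by (intro borel_measurable_continuous_onI continuous_osc)

lemma integrable_exp_minus_abs_shift: "integrable lborel (\<lambda>y. exp (- \<bar>y - X\<bar>))" for X :: real
  using lborel_integrable_real_affine[OF integrable_exp_minus_abs, of 1 "- X"] by simp

lemma integral_exp_minus_abs_shift:
  "(LINT y|lborel. exp (- \<bar>y - X\<bar>)) = (LINT y|lborel. exp (- \<bar>y\<bar>))" for X :: real
  using lborel_integral_real_affine[of 1 "\<lambda>y. exp (- \<bar>y\<bar>)" "- X"] by simp

lemma cmod_osc_le:
  assumes "exp (cmod z * \<bar>y - X\<bar>) * cmod (\<psi> (y - X)) \<le> D"
  shows "cmod (osc z c m \<psi> X \<xi> y) \<le> exp (cmod z * \<bar>X\<bar>) * D"
proof -
  have "cmod (osc z c m \<psi> X \<xi> y) = exp (Re z * y) * cmod (\<psi> (y - X))"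
    by (simp add: osc_def norm_mult)
  also have "\<dots> \<le> exp (cmod z * \<bar>X\<bar>) * exp (cmod z * \<bar>y - X\<bar>) * cmod (\<psi> (y - X))"
    by (intro mult_right_mono exp_Re_le) auto
  also have "\<dots> \<le> exp (cmod z * \<bar>X\<bar>) * D"
    unfolding mult.assoc by (intro mult_left_mono assms) auto
  finally show ?thesis .
qed

text \<open>The line is split at distance \<open>R\<close> from \<open>X\<close>: outside, the decay
  of the window yields the factor in \<open>R powr (1 / t)\<close> and leaves
  \<open>exp (- \<bar>y - X\<bar>)\<close> to integrate. For \<open>R = 0\<close> the integral over
  the interval disappears and a crude bound, uniform in \<open>\<xi>\<close>, remains.\<close>

lemma osc_integral_bound:
  fixes C a t R :: real
  assumes cont: "continuous_on UNIV \<psi>" and C: "C \<ge> 0" and a: "a \<ge> 0" and t: "t > 0" and R: "R \<ge> 0"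
    and le: "\<And>w. exp (cmod z * \<bar>w\<bar>) * cmod (\<psi> w) \<le> C * exp (- \<bar>w\<bar>) * exp (- a * \<bar>w\<bar> powr (1 / t))"
  shows "integrable lborel (osc z c m \<psi> X \<xi>)"
    and "cmod (LINT y|lborel. osc z c m \<psi> X \<xi> y) \<le>
      cmod (integral {X - R..X + R} (osc z c m \<psi> X \<xi>)) +
      exp (cmod z * \<bar>X\<bar>) * C * exp (- a * R powr (1 / t)) * (LINT y|lborel. exp (- \<bar>y\<bar>))"
proof -
  define K where "K = exp (cmod z * \<bar>X\<bar>)"
  define G where "G = osc z c m \<psi> X \<xi>"
  define I where "I = {X - R..X + R}"
  have G_meas [measurable]: "G \<in> borel_measurable borel"
    unfolding G_def by (rule osc_borel[OF cont])
  have G_le: "cmod (G y) \<le> K * C * exp (- a * \<bar>y - X\<bar> powr (1 / t)) * exp (- \<bar>y - X\<bar>)" for y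
    unfolding G_def K_def using cmod_osc_le[of z y X \<psi>, OF le[of "y - X"]] by (simp add: mult_ac)
  have G_le1: "cmod (G y) \<le> K * C * exp (- a * R powr (1 / t)) * exp (- \<bar>y - X\<bar>)"
    if "\<bar>y - X\<bar> \<ge> R" for y
  proof -
    have "R powr (1 / t) \<le> \<bar>y - X\<bar> powr (1 / t)"
      using R t that by (intro powr_mono2) auto
    then have "exp (- a * \<bar>y - X\<bar> powr (1 / t)) \<le> exp (- a * R powr (1 / t))"
      using a by (simp add: mult_left_mono)
    then have "K * C * exp (- a * \<bar>y - X\<bar> powr (1 / t)) * exp (- \<bar>y - X\<bar>) \<le>
      K * C * exp (- a * R powr (1 / t)) * exp (- \<bar>y - X\<bar>)"
      using C by (intro mult_right_mono mult_left_mono) (auto simp: K_def)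
    with G_le[of y] show ?thesis by linarith
  qed
  have G_le2: "cmod (G y) \<le> K * C * exp (- \<bar>y - X\<bar>)" for y
  proof -
    have "K * C * exp (- a * \<bar>y - X\<bar> powr (1 / t)) * exp (- \<bar>y - X\<bar>) \<le> K * C * 1 * exp (- \<bar>y - X\<bar>)"
      using C a by (intro mult_right_mono mult_left_mono) (auto simp: K_def)
    with G_le[of y] show ?thesis by simp
  qed
  have int: "integrable lborel G"
    by (rule Bochner_Integration.integrable_bound
        [OF integrable_mult_right[OF integrable_exp_minus_abs_shift[of X], of "K * C"]])
       (use C G_le2 in \<open>auto simp: K_def abs_mult\<close>)
  then show "integrable lborel (osc z c m \<psi> X \<xi>)" by (simp add: G_def)
  have intI: "set_integrable lborel I G" and intI': "set_integrable lborel (- I) G"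
    using int by (auto simp: set_integrable_def I_def intro!: integrable_mult_indicator)
  have "(LINT y|lborel. G y) = (LINT y:I|lborel. G y) + (LINT y:- I|lborel. G y)"
    using set_integral_Un[OF _ intI intI'] by (simp add: set_lebesgue_integral_def)
  also have "(LINT y:I|lborel. G y) = integral I G"
    by (rule set_borel_integral_eq_integral(2)[OF intI])
  finally have "cmod (LINT y|lborel. G y) \<le> cmod (integral I G) + cmod (LINT y:- I|lborel. G y)"
    by (simp add: norm_triangle_ineq)
  also have "cmod (LINT y:- I|lborel. G y) \<le>
     (LINT y|lborel. K * C * exp (- a * R powr (1 / t)) * exp (- \<bar>y - X\<bar>))"
    unfolding set_lebesgue_integral_def
  proof (rule Bochner_Integration.integral_norm_bound_integral)
    show "cmod (indicator (- I) y *\<^sub>R G y) \<le> K * C * exp (- a * R powr (1 / t)) * exp (- \<bar>y - X\<bar>)" for y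
      using G_le1[of y] C by (auto simp: I_def indicator_def K_def)
  qed (use intI' integrable_exp_minus_abs_shift in \<open>auto simp: set_integrable_def\<close>)
  also have "\<dots> = K * C * exp (- a * R powr (1 / t)) * (LINT y|lborel. exp (- \<bar>y\<bar>))"
    by (simp add: integral_exp_minus_abs_shift)
  finally show "cmod (LINT y|lborel. osc z c m \<psi> X \<xi> y) \<le>
      cmod (integral {X - R..X + R} (osc z c m \<psi> X \<xi>)) +
      exp (cmod z * \<bar>X\<bar>) * C * exp (- a * R powr (1 / t)) * (LINT y|lborel. exp (- \<bar>y\<bar>))"
    by (simp add: G_def K_def I_def)
qed

section \<open>Lower bounds for the derivative of the phase off the curve\<close>

lemma phase'_bounded_below:
  assumes "\<xi>0 \<noteq> c * real m * x0 ^ (m - 1)"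
  obtains \<delta> \<epsilon> where "\<delta> > 0" "\<epsilon> > 0"
    "\<And>x \<xi> u. \<bar>x - x0\<bar> < \<delta> \<Longrightarrow> \<bar>\<xi> - \<xi>0\<bar> < \<delta> \<Longrightarrow> cmod u \<le> 2 * \<delta> \<Longrightarrow>
        \<epsilon> \<le> cmod (phase' 0 c m \<xi> (of_real x + u))"
proof -
  \<comment> \<open>Joint continuity in \<open>x\<close>, \<open>\<xi>\<close> and the complex
    displacement \<open>u\<close> carries the non-vanishing at the given point over to a
    neighbourhood, with half the modulus as lower bound.\<close>
  define F where "F = (\<lambda>p. phase' 0 c m (fst (snd p)) (of_real (fst p) + snd (snd p)))"
  have "phase' 0 c m \<xi>0 (of_real x0) = \<i> * of_real (c * real m * x0 ^ (m - 1) - \<xi>0)"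
    by (simp add: phase'_def algebra_simps)
  then have F0: "F (x0, \<xi>0, 0) \<noteq> 0" using assms by (simp add: F_def del: of_real_diff)
  define \<epsilon> where "\<epsilon> = cmod (F (x0, \<xi>0, 0)) / 2"
  have \<epsilon>: "\<epsilon> > 0" "\<epsilon> < cmod (F (x0, \<xi>0, 0))" using F0 by (auto simp: \<epsilon>_def)
  have "continuous_on UNIV F" unfolding F_def phase'_def by (intro continuous_intros)
  then have "open {p. \<epsilon> < cmod (F p)}" by (intro open_Collect_less continuous_intros)
  then obtain A B where A: "open A" "x0 \<in> A" and B: "open B" "(\<xi>0, 0) \<in> B"
    and AB: "A \<times> B \<subseteq> {p. \<epsilon> < cmod (F p)}"
    using \<epsilon> by (elim open_prod_elim[where x = "(x0, \<xi>0, 0)"]) auto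
  obtain B1 B2 where B1: "open B1" "\<xi>0 \<in> B1" and B2: "open B2" "0 \<in> B2" and BB: "B1 \<times> B2 \<subseteq> B"
    using B by (elim open_prod_elim) auto
  obtain d1 d2 d3 where d: "d1 > 0" "ball x0 d1 \<subseteq> A" "d2 > 0" "ball \<xi>0 d2 \<subseteq> B1" "d3 > 0" "ball 0 d3 \<subseteq> B2"
    using A B1 B2 by (metis open_contains_ball)
  show ?thesis
  \<comment> \<open>One radius serves points and displacements alike; \<open>u\<close> may be as
    large as \<open>2 * \<delta>\<close>, hence a third of \<open>d3\<close>.\<close>
  proof (rule that[of "min d1 (min d2 (d3 / 3))" \<epsilon>])
    fix x \<xi> :: real and u :: complex
    assume "\<bar>x - x0\<bar> < min d1 (min d2 (d3 / 3))" "\<bar>\<xi> - \<xi>0\<bar> < min d1 (min d2 (d3 / 3))"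
      "cmod u \<le> 2 * min d1 (min d2 (d3 / 3))"
    then have "x \<in> A" "\<xi> \<in> B1" "u \<in> B2"
      using d by (auto simp: subset_iff dist_real_def abs_minus_commute)
    then have "(x, \<xi>, u) \<in> {p. \<epsilon> < cmod (F p)}" using AB BB by blast
    then show "\<epsilon> \<le> cmod (phase' 0 c m \<xi> (of_real x + u))" by (simp add: F_def)
  qed (use d \<epsilon> in auto)
qed

text \<open>For \<open>z = 0\<close> the derivative is homogeneous: scaling positions by
  \<open>l powr t\<close> and frequencies by \<open>l powr (t * (real m - 1))\<close> multiplies it
  by the latter factor. The constant \<open>z\<close> costs at most its modulus.\<close>

lemma phase'_scaled:
  fixes l t :: real and y :: complex
  assumes l: "l > 0" and m: "m \<ge> 1"
    and le: "\<epsilon> \<le> cmod (phase' 0 c m \<xi> (of_real x + y / of_real (l powr t)))"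
  shows "l powr (t * (real m - 1)) * \<epsilon> - cmod z \<le>
    cmod (phase' z c m (l powr (t * (real m - 1)) * \<xi>) (of_real (l powr t * x) + y))"
proof -
  define u where "u = of_real x + y / of_real (l powr t)"
  have *: "l powr (t * (real m - 1)) = (l powr t) ^ (m - 1)"
    using m l by (simp add: powr_powr of_nat_diff flip: powr_realpow)
  have "of_real (l powr t * x) + y = of_real (l powr t) * u"
    using l by (simp add: u_def distrib_left)
  then have eq: "phase' z c m (l powr (t * (real m - 1)) * \<xi>) (of_real (l powr t * x) + y) =
    of_real (l powr (t * (real m - 1))) * phase' 0 c m \<xi> u + z"
    unfolding phase'_def * by (simp only: power_mult_distrib of_real_power of_real_mult) (simp add: algebra_simps)
  have "cmod (of_real (l powr (t * (real m - 1))) * phase' 0 c m \<xi> u + z) \<ge>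
      l powr (t * (real m - 1)) * cmod (phase' 0 c m \<xi> u) - cmod z"
    using norm_diff_ineq[of "of_real (l powr (t * (real m - 1))) * phase' 0 c m \<xi> u" z]
    by (simp add: norm_mult)
  moreover have "l powr (t * (real m - 1)) * \<epsilon> \<le> l powr (t * (real m - 1)) * cmod (phase' 0 c m \<xi> u)"
    using le by (intro mult_left_mono) (auto simp: u_def)
  ultimately show ?thesis unfolding eq by linarith
qed

lemma fact_powr_le_powr:
  fixes l s :: real
  assumes "s \<ge> 0" "real k \<le> l"
  shows "fact k powr s \<le> (l powr s) ^ k"
proof (cases "k = 0")
  case False
  then have l: "l > 0" using assms by linarith
  have "fact k \<le> (real k ^ k :: real)" using fact_le_power[of k, where ?'a = real] by simp
  also have "\<dots> \<le> l ^ k" using assms by (intro power_mono) auto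
  finally have "fact k powr s \<le> (l ^ k) powr s" using assms by (intro powr_mono2) auto
  also have "\<dots> = (l powr s) ^ k"
    using l by (simp add: powr_powr mult.commute flip: powr_realpow)
  finally show ?thesis .
qed simp

text \<open>The neighbourhood is fixed before the rate \<open>r\<close>; only the parameters
  \<open>a\<close> and \<open>H\<close> of the window estimate depend on \<open>r\<close>. They can
  be prescribed freely because bounds of Beurling type hold at every scale \<open>h\<close>.\<close>

lemma nonstationary_decay:
  fixes z :: complex and c t s x0 \<xi>0 :: real and m :: nat
  assumes \<psi>: "\<psi> \<in> GS_space t s" and t: "0 < t" "t \<le> 1" and m: "m \<ge> 1"
    and s: "s = t * (real m - 1)" "s \<ge> 1"
    and ns: "\<xi>0 \<noteq> c * real m * x0 ^ (m - 1)"
  obtains \<delta> where "\<delta> > 0"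
    "\<And>r. \<exists>M. \<forall>l x \<xi>. l > 0 \<longrightarrow> \<bar>x - x0\<bar> < \<delta> \<longrightarrow> \<bar>\<xi> - \<xi>0\<bar> < \<delta> \<longrightarrow>
        exp (r * l) * cmod (LINT y|lborel. osc z c m \<psi> (l powr t * x) (l powr s * \<xi>) y) \<le> M"
proof -
  obtain \<delta> \<epsilon> where \<delta>: "\<delta> > 0" and \<epsilon>: "\<epsilon> > 0" and
    low: "\<And>x \<xi> u. \<bar>x - x0\<bar> < \<delta> \<Longrightarrow> \<bar>\<xi> - \<xi>0\<bar> < \<delta> \<Longrightarrow> cmod u \<le> 2 * \<delta> \<Longrightarrow>
        \<epsilon> \<le> cmod (phase' 0 c m \<xi> (of_real x + u))"
    using phase'_bounded_below[OF ns] by blast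
  define b where "b = cmod z"
  define K where "K = \<bar>x0\<bar> + \<delta>"
  define J where "J = (LINT y|lborel. exp (- \<bar>y::real\<bar>))"
  have bK: "b \<ge> 0" "K \<ge> 0" "J \<ge> 0" using \<delta> by (auto simp: b_def K_def J_def)
  have cont: "continuous_on UNIV \<psi>" and sm: "smooth \<psi>"
    using GS_space_continuous[OF \<psi>] \<psi> by (auto simp: GS_space_def)
  have "\<exists>M. \<forall>l x \<xi>. l > 0 \<longrightarrow> \<bar>x - x0\<bar> < \<delta> \<longrightarrow> \<bar>\<xi> - \<xi>0\<bar> < \<delta> \<longrightarrow>
        exp (r * l) * cmod (LINT y|lborel. osc z c m \<psi> (l powr t * x) (l powr s * \<xi>) y) \<le> M"
    (is "\<exists>M. \<forall>l x \<xi>. _ \<longrightarrow> _ \<longrightarrow> _ \<longrightarrow> ?F l x \<xi> \<le> M") for r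
  proof -
    \<comment> \<open>\<open>\<bar>r\<bar>\<close> is the rate wanted, \<open>b * K\<close> pays for
      the growth \<open>exp (b * \<bar>X\<bar>)\<close>, and 1 absorbs a factor \<open>l\<close>.
      Next, \<open>a\<close> is chosen such that the window decays like
      \<open>exp (- r' * l)\<close> at distance \<open>\<delta> * l powr t\<close>, and
      \<open>H\<close> such that \<open>2 * B * H\<close> will equal
      \<open>exp (- r') / l powr s\<close>.\<close>
    define r' where "r' = \<bar>r\<bar> + b * K + 1"
    define a where "a = r' / \<delta> powr (1 / t)"
    define H where "H = \<epsilon> / 4 * exp (- r')"
    have r': "r' > 0" using bK by (simp add: r'_def add_nonneg_pos)
    have a: "a \<ge> 0" "a * \<delta> powr (1 / t) = r'" using r' \<delta> by (auto simp: a_def)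
    have H: "H > 0" using \<epsilon> by (simp add: H_def)
    obtain C where C: "C \<ge> 0" and
      C_le: "\<And>n w. exp (b * \<bar>w\<bar>) * cmod (nth_vderiv n \<psi> w) \<le>
       C * exp (- \<bar>w\<bar>) * exp (- a * \<bar>w\<bar> powr (1 / t)) * H ^ n * fact n powr s"
      using GS_deriv_weighted_decay[OF \<psi> t a(1) bK(1) H] by blast
    have C_le0: "exp (cmod z * \<bar>w\<bar>) * cmod (\<psi> w) \<le> C * exp (- \<bar>w\<bar>) * exp (- a * \<bar>w\<bar> powr (1 / t))" for w
      using C_le[of w 0] by (simp add: nth_vderiv_def b_def)
    \<comment> \<open>Beyond \<open>l0\<close>, the first power ensures
      \<open>1 / R \<le> H / 2\<close>, and the second makes \<open>cmod z\<close> at most half of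
      the homogeneous lower bound.\<close>
    define l0 where "l0 = max 1 (max ((2 / (\<delta> * H)) powr (1 / t)) ((2 * b / \<epsilon>) powr (1 / s)))"
    have l0: "l0 \<ge> 1" by (simp add: l0_def)
    have X_le: "\<bar>l powr t * x\<bar> \<le> K * max 1 l" if "l > 0" "\<bar>x - x0\<bar> < \<delta>" for l x
    proof -
      have "l powr t \<le> max 1 l powr t" using that t by (intro powr_mono2) auto
      also have "\<dots> \<le> max 1 l powr 1" using t by (intro powr_mono) auto
      finally have "l powr t * \<bar>x\<bar> \<le> max 1 l * K"
        using that by (intro mult_mono) (auto simp: K_def)
      then show ?thesis by (simp add: abs_mult mult.commute)
    qed
    \<comment> \<open>Bounded \<open>l\<close>: no oscillation is used, only the crude bound with
      \<open>R = 0\<close>.\<close>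
    have small: "?F l x \<xi> \<le> exp (\<bar>r\<bar> * l0) * (exp (b * (K * l0)) * C * J)"
      if l: "l > 0" "l \<le> l0" and x: "\<bar>x - x0\<bar> < \<delta>" for l x \<xi>
    proof -
      have "cmod (LINT y|lborel. osc z c m \<psi> (l powr t * x) (l powr s * \<xi>) y) \<le>
          exp (cmod z * \<bar>l powr t * x\<bar>) * C * J"
        using osc_integral_bound(2)[OF cont C a(1) t(1) order.refl C_le0] t by (simp add: J_def)
      also have "\<dots> \<le> exp (b * (K * l0)) * C * J"
      proof -
        have "K * max 1 l \<le> K * l0" using l l0 bK by (intro mult_left_mono) auto
        with X_le[OF l(1) x] have "\<bar>l powr t * x\<bar> \<le> K * l0" by linarith
        then show ?thesis using bK C unfolding b_def by (intro mult_right_mono) (auto intro!: mult_left_mono)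
      qed
      finally have *: "cmod (LINT y|lborel. osc z c m \<psi> (l powr t * x) (l powr s * \<xi>) y) \<le>
          exp (b * (K * l0)) * C * J" .
      have "r * l \<le> \<bar>r\<bar> * l0" using l by (intro mult_mono) auto
      then show ?thesis by (intro mult_mono *) auto
    qed
    have large: "?F l x \<xi> \<le> C * (4 / \<epsilon> + 2 * \<delta> * exp r' + J)"
      if l: "l \<ge> l0" and x: "\<bar>x - x0\<bar> < \<delta>" and \<xi>: "\<bar>\<xi> - \<xi>0\<bar> < \<delta>" for l x \<xi>
    proof -
      have l1: "l \<ge> 1" using l l0 by linarith
      define R where "R = \<delta> * l powr t"
      define X where "X = l powr t * x"
      define B where "B = 2 / (\<epsilon> * l powr s)"
      \<comment> \<open>For \<open>k\<close> up to \<open>N\<close> one has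
        \<open>fact k powr s \<le> (l powr s) ^ k\<close>, which cancels the denominator of
        \<open>2 * B * H\<close>; and \<open>N\<close> exceeds \<open>l - 1\<close>, so the
        remainder loses only the constant \<open>exp r'\<close>.\<close>
      define N where "N = nat \<lfloor>l\<rfloor>"
      have N: "real N \<le> l" "l \<le> real N + 1" using l1 by (auto simp: N_def) 
      have pos: "R > 0" "B > 0" using \<delta> \<epsilon> l1 by (auto simp: R_def B_def)
      have s_pos: "s > 0" using s by simp
      have "((2 / (\<delta> * H)) powr (1 / t)) powr t \<le> l powr t"
        using l t by (intro powr_mono2) (auto simp: l0_def)
      then have "2 / (\<delta> * H) \<le> l powr t" using t \<delta> H by (simp add: powr_powr)
      then have RH: "1 / R \<le> H / 2"
        using \<delta> H l1 by (simp add: R_def field_simps)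
      have "((2 * b / \<epsilon>) powr (1 / s)) powr s \<le> l powr s"
        using l s_pos by (intro powr_mono2) (auto simp: l0_def)
      then have "2 * b / \<epsilon> \<le> l powr s" using s_pos bK \<epsilon> by (simp add: powr_powr)
      then have b_le: "b \<le> l powr s * \<epsilon> / 2" using \<epsilon> by (simp add: field_simps)
      have B_low: "1 \<le> B * cmod (phase' z c m (l powr s * \<xi>) y)"
        if y: "cmod (y - of_real X) \<le> 2 * R" for y
      proof -
        have "cmod ((y - of_real X) / of_real (l powr t)) \<le> 2 * \<delta>"
          using y l1 by (simp add: norm_divide R_def divide_le_eq mult_ac)
        from low[OF x \<xi> this] phase'_scaled[of l m \<epsilon> c \<xi> x "y - of_real X" t z] l1 m
        have "l powr s * \<epsilon> - b \<le> cmod (phase' z c m (l powr s * \<xi>) (of_real (l powr t * x) + (y - of_real X)))"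
          by (simp add: s b_def)
        then have "l powr s * \<epsilon> / 2 \<le> cmod (phase' z c m (l powr s * \<xi>) y)"
          using b_le by (simp add: X_def)
        then have "B * (l powr s * \<epsilon> / 2) \<le> B * cmod (phase' z c m (l powr s * \<xi>) y)"
          using pos by (intro mult_left_mono) auto
        moreover have "B * (l powr s * \<epsilon> / 2) = 1" using \<epsilon> l1 by (simp add: B_def)
        ultimately show ?thesis by simp
      qed
      define T where "T k = (2 * B * H) ^ k * fact k powr s" for k
      have BH: "2 * B * H = exp (- r') / l powr s" using \<epsilon> l1 by (simp add: B_def H_def field_simps)
      have T_le: "T k \<le> exp (- r') ^ k" if "k \<le> N" for k
      proof -
        have "T k \<le> (2 * B * H) ^ k * (l powr s) ^ k"
          unfolding T_def using that N s_pos pos H by (intro mult_left_mono fact_powr_le_powr) auto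
        also have "\<dots> = exp (- r') ^ k" using l1 by (simp add: BH power_divide)
        finally show ?thesis .
      qed
      have "(\<Sum>k<N. T k) \<le> (\<Sum>k<N. 1)"
        using T_le r' by (intro sum_mono order_trans[OF T_le] power_le_one) auto
      then have sumT: "(\<Sum>k<N. T k) \<le> l" using N by simp
      have "T N \<le> exp (- r') ^ N" by (rule T_le) simp
      also have "exp (- r') ^ N = exp (real N * - r')" by (rule exp_of_nat_mult[symmetric])
      also have "\<dots> \<le> exp (r' + - r' * l)"
        using mult_left_mono[OF N(2), of r'] r' by (simp add: algebra_simps)
      finally have TN: "T N \<le> exp r' * exp (- r' * l)" by (simp only: exp_add)
      have "R powr (1 / t) = \<delta> powr (1 / t) * l"
        using t l1 \<delta> by (simp add: R_def powr_mult powr_powr)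
      then have "a * R powr (1 / t) = r' * l" by (simp only: mult.assoc[symmetric] a(2))
      then have eR: "exp (- a * R powr (1 / t)) = exp (- r' * l)" by simp
      have lt: "l powr t \<le> l" using powr_mono[of t 1 l] t l1 by simp
      have ls: "1 \<le> l powr s" using l1 s_pos by (simp add: ge_one_powr_ge_zero)
      have B_le: "B \<le> 2 / \<epsilon>"
        using \<epsilon> ls by (simp add: B_def frac_le)
      have R_le: "R \<le> \<delta> * l" unfolding R_def using lt \<delta> by (intro mult_left_mono) auto
      have "cmod (LINT y|lborel. osc z c m \<psi> X (l powr s * \<xi>) y) \<le>
          exp (b * \<bar>X\<bar>) * C * (2 * B * exp (- r' * l) * (\<Sum>k<N. T k) + 2 * R * T N)
          + exp (b * \<bar>X\<bar>) * C * exp (- r' * l) * J"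
        using osc_integral_bound(2)[OF cont C a(1) t(1) less_imp_le[OF pos(1)] C_le0, of c m X "l powr s * \<xi>"]
          nonstationary_integral_bound[where X = X and N = N, OF sm a(1) s(2) pos(1) RH pos(2) B_low C C_le[unfolded b_def]]
        unfolding osc_def[symmetric, abs_def] eR J_def b_def T_def[symmetric] by linarith
      also have "\<dots> = exp (b * \<bar>X\<bar>) * C * (2 * B * exp (- r' * l) * (\<Sum>k<N. T k) + 2 * R * T N + exp (- r' * l) * J)"
        by (simp add: distrib_left mult.assoc)
      \<comment> \<open>Every summand becomes a constant times \<open>l * exp (- r' * l)\<close>;
        for the last one this uses \<open>l \<ge> 1\<close>.\<close>
      also have "\<dots> \<le> exp (b * \<bar>X\<bar>) * C * (2 * (2 / \<epsilon>) * exp (- r' * l) * l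
         + 2 * (\<delta> * l) * (exp r' * exp (- r' * l)) + exp (- r' * l) * (l * J))"
      proof (intro mult_left_mono add_mono mult_mono B_le R_le sumT TN)
        show "0 \<le> T N" "0 \<le> (\<Sum>k<N. T k)"
          using pos H by (auto simp: T_def intro!: sum_nonneg)
        show "J \<le> l * J" using l1 bK by (simp add: mult_le_cancel_right1)
      qed (use pos \<epsilon> \<delta> l1 C in auto)
      also have "\<dots> = exp (b * \<bar>X\<bar>) * (l * exp (- r' * l)) * (C * (4 / \<epsilon> + 2 * \<delta> * exp r' + J))"
        by (simp add: algebra_simps)
      also have "\<dots> \<le> exp (b * (K * l)) * (exp l * exp (- r' * l)) * (C * (4 / \<epsilon> + 2 * \<delta> * exp r' + J))"
      proof (intro mult_right_mono mult_mono)
        show "exp (b * \<bar>X\<bar>) \<le> exp (b * (K * l))"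
          using X_le[of l x] x l1 bK by (auto simp: X_def intro!: mult_left_mono)
        show "l \<le> exp l" using exp_ge_add_one_self[of l] by linarith
      qed (use l1 C \<epsilon> \<delta> bK in auto)
      also have "exp (b * (K * l)) * (exp l * exp (- r' * l)) = exp (- \<bar>r\<bar> * l)"
        by (simp add: r'_def algebra_simps flip: exp_add)
      finally have "exp (r * l) * cmod (LINT y|lborel. osc z c m \<psi> X (l powr s * \<xi>) y) \<le>
          exp (r * l) * (exp (- \<bar>r\<bar> * l) * (C * (4 / \<epsilon> + 2 * \<delta> * exp r' + J)))"
        by (rule mult_left_mono) simp
      also have "\<dots> = exp (r * l - \<bar>r\<bar> * l) * (C * (4 / \<epsilon> + 2 * \<delta> * exp r' + J))"
        by (simp add: exp_diff exp_minus divide_inverse)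
      also have "\<dots> \<le> 1 * (C * (4 / \<epsilon> + 2 * \<delta> * exp r' + J))"
        using l1 C \<epsilon> \<delta> bK by (intro mult_right_mono) (auto intro!: mult_right_mono)
      finally show ?thesis by (simp add: X_def)
    qed
    show ?thesis
      by (rule exI[where x = "max (exp (\<bar>r\<bar> * l0) * (exp (b * (K * l0)) * C * J))
           (C * (4 / \<epsilon> + 2 * \<delta> * exp r' + J))"])
        (metis small large le_max_iff_disj linorder_le_cases)
  qed
  then show ?thesis using that \<delta> by blast
qed

section \<open>Gaussian averages at a stationary point\<close>

text \<open>Completing the square. The Gaussian thereby dominates the growth caused by
  \<open>z\<close> and still leaves an integrable factor.\<close>

lemma gaussian_le_exp_minus_abs:
  fixes b u :: real
  shows "exp (b * \<bar>u\<bar>) * exp (- u\<^sup>2 / 2) \<le> exp ((b + 1)\<^sup>2 / 2) * exp (- \<bar>u\<bar>)"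
proof -
  have "0 \<le> (\<bar>u\<bar> - (b + 1))\<^sup>2" by simp
  also have "(\<bar>u\<bar> - (b + 1))\<^sup>2 = u\<^sup>2 - 2 * (b + 1) * \<bar>u\<bar> + (b + 1)\<^sup>2"
    by (simp add: power2_diff mult_ac)
  finally have "b * \<bar>u\<bar> + - u\<^sup>2 / 2 \<le> (b + 1)\<^sup>2 / 2 + - \<bar>u\<bar>"
    by (simp add: algebra_simps)
  then show ?thesis by (simp flip: exp_add)
qed

lemma integrable_gaussian: "integrable lborel (\<lambda>x::real. exp (- x\<^sup>2 / 2))"
  using gaussian_le_exp_minus_abs[of 0]
  by (intro Bochner_Integration.integrable_bound
      [OF integrable_mult_right[OF integrable_exp_minus_abs, of "exp (1 / 2)"]]) auto

lemma gaussian_fourier: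
  "(LINT x|lborel. of_real (exp (- x\<^sup>2 / 2)) * iexp (t * x)) = of_real (sqrt (2 * pi) * exp (- t\<^sup>2 / 2))"
proof -
  have "char std_normal_distribution t = (LINT x|lborel. std_normal_density x *\<^sub>R iexp (t * x))"
    unfolding char_def by (subst integral_density) (auto simp: normal_density_nonneg)
  also have "\<dots> = (LINT x|lborel. of_real (1 / sqrt (2 * pi)) * (of_real (exp (- x\<^sup>2 / 2)) * iexp (t * x)))"
    by (intro Bochner_Integration.integral_cong) (auto simp: std_normal_density_def scaleR_conv_of_real)
  also have "\<dots> = of_real (1 / sqrt (2 * pi)) * (LINT x|lborel. of_real (exp (- x\<^sup>2 / 2)) * iexp (t * x))"
    by simp
  finally show ?thesis by (simp add: char_std_normal_distribution field_simps)
qed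

text \<open>Fubini's theorem, the Fourier transform of the Gaussian and the substitution
  \<open>y = Y + u / \<sigma>\<close>. A Gaussian average over frequencies on scale
  \<open>\<sigma>\<close> thus localises in \<open>y\<close> to width \<open>1 / \<sigma>\<close>
  about \<open>Y\<close>.\<close>

lemma gaussian_average:
  fixes G :: "real \<Rightarrow> complex" and \<sigma> Y :: real
  assumes G: "integrable lborel G" and \<sigma>: "\<sigma> > 0"
  shows "(LINT \<tau>|lborel. of_real (exp (- \<tau>\<^sup>2 / 2)) * (LINT y|lborel. iexp (- (\<sigma> * (y - Y)) * \<tau>) * G y)) =
     of_real (sqrt (2 * pi) / \<sigma>) * (LINT u|lborel. of_real (exp (- u\<^sup>2 / 2)) * G (Y + u / \<sigma>))"
proof -
  define f where "f \<tau> y = of_real (exp (- \<tau>\<^sup>2 / 2)) * (iexp (- (\<sigma> * (y - Y)) * \<tau>) * G y)" for \<tau> y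
  have [measurable]: "G \<in> borel_measurable borel"
    using borel_measurable_integrable[OF G] by simp
  have norm_f: "cmod (f \<tau> y) = exp (- \<tau>\<^sup>2 / 2) * cmod (G y)" for \<tau> y
    by (simp add: f_def norm_mult)
  have "integrable (lborel \<Otimes>\<^sub>M lborel) (case_prod f)"
  proof (rule lborel_pair.Fubini_integrable)
    show "(case_prod f) \<in> borel_measurable (lborel \<Otimes>\<^sub>M lborel)"
      unfolding f_def by measurable
    show "integrable lborel (\<lambda>\<tau>. LINT y|lborel. norm (case_prod f (\<tau>, y)))"
      using integrable_gaussian by (simp add: norm_f)
    show "AE \<tau> in lborel. integrable lborel (\<lambda>y. case_prod f (\<tau>, y))"
    proof (rule AE_I2)
      fix \<tau> :: real
      have "integrable lborel (f \<tau>)"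
      proof (rule Bochner_Integration.integrable_bound)
        show "integrable lborel (\<lambda>y. exp (- \<tau>\<^sup>2 / 2) *\<^sub>R G y)" using G by simp
        show "f \<tau> \<in> borel_measurable lborel" unfolding f_def by measurable
      qed (simp add: norm_f)
      then show "integrable lborel (\<lambda>y. case_prod f (\<tau>, y))" by simp
    qed
  qed
  then have "(LINT \<tau>|lborel. LINT y|lborel. f \<tau> y) = (LINT y|lborel. LINT \<tau>|lborel. f \<tau> y)"
    by (rule lborel_pair.Fubini_integral[symmetric])
  also have "\<dots> = (LINT y|lborel. G y * of_real (sqrt (2 * pi) * exp (- (\<sigma> * (y - Y))\<^sup>2 / 2)))"
  proof (rule Bochner_Integration.integral_cong[OF refl])
    fix y
    have "(LINT \<tau>|lborel. f \<tau> y) =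
        G y * (LINT \<tau>|lborel. of_real (exp (- \<tau>\<^sup>2 / 2)) * iexp (- (\<sigma> * (y - Y)) * \<tau>))"
      unfolding f_def by (simp add: mult_ac flip: integral_mult_right_zero)
    then show "(LINT \<tau>|lborel. f \<tau> y) = G y * of_real (sqrt (2 * pi) * exp (- (\<sigma> * (y - Y))\<^sup>2 / 2))"
      by (simp only: gaussian_fourier power2_minus)
  qed
  also have "\<dots> = \<bar>1 / \<sigma>\<bar> *\<^sub>R (LINT u|lborel. G (Y + 1 / \<sigma> * u) *
       of_real (sqrt (2 * pi) * exp (- (\<sigma> * ((Y + 1 / \<sigma> * u) - Y))\<^sup>2 / 2)))"
    by (rule lborel_integral_real_affine) (use \<sigma> in simp)
  also have "\<dots> = \<bar>1 / \<sigma>\<bar> *\<^sub>R (LINT u|lborel. of_real (sqrt (2 * pi)) * (of_real (exp (- u\<^sup>2 / 2)) * G (Y + u / \<sigma>)))"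
    using \<sigma> by (simp add: mult_ac)
  also have "\<dots> = of_real (sqrt (2 * pi) / \<sigma>) * (LINT u|lborel. of_real (exp (- u\<^sup>2 / 2)) * G (Y + u / \<sigma>))"
    using \<sigma> by (simp add: scaleR_conv_of_real)
  finally show ?thesis by (simp add: f_def)
qed

lemma osc_modulate: "osc z c m \<psi> X (\<xi> + \<eta>) y = iexp (- \<eta> * y) * osc z c m \<psi> X \<xi> y"
  by (simp add: osc_def phase_def algebra_simps flip: exp_add)

text \<open>\<open>D1\<close> stands for the decay assumed near the central frequency,
  \<open>D2\<close> for a crude bound at all frequencies. The Gaussian is split into two equal
  factors: one gains \<open>exp (- T\<^sup>2 / 4)\<close> outside the central range, the other keeps
  the integral over \<open>\<tau>\<close> finite.\<close>

lemma gaussian_average_osc_le: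
  fixes D1 D2 T \<sigma> X Y \<xi> :: real
  assumes int: "integrable lborel (osc z c m \<psi> X \<xi>)" and \<sigma>: "\<sigma> > 0" and T: "T \<ge> 0"
    and D1: "D1 \<ge> 0" "\<And>\<tau>. \<bar>\<tau>\<bar> \<le> T \<Longrightarrow> cmod (LINT y|lborel. osc z c m \<psi> X (\<xi> + \<sigma> * \<tau>) y) \<le> D1"
    and D2: "D2 \<ge> 0" "\<And>\<tau>. cmod (LINT y|lborel. osc z c m \<psi> X (\<xi> + \<sigma> * \<tau>) y) \<le> D2"
  shows "cmod (LINT u|lborel. of_real (exp (- u\<^sup>2 / 2)) * osc z c m \<psi> X \<xi> (Y + u / \<sigma>)) \<le>
     \<sigma> * ((D1 + D2 * exp (- T\<^sup>2 / 4)) * exp 1 * (LINT y|lborel. exp (- \<bar>y\<bar>)))"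
proof -
  define G where "G = osc z c m \<psi> X \<xi>"
  define W where "W \<tau> = (LINT y|lborel. iexp (- (\<sigma> * (y - Y)) * \<tau>) * G y)" for \<tau>
  define S where "S = (LINT u|lborel. of_real (exp (- u\<^sup>2 / 2)) * G (Y + u / \<sigma>))"
  \<comment> \<open>Centring the modulation at \<open>Y\<close> only contributes a factor of modulus
    one.\<close>
  have W: "cmod (W \<tau>) = cmod (LINT y|lborel. osc z c m \<psi> X (\<xi> + \<sigma> * \<tau>) y)" for \<tau>
  proof -
    have "iexp (- (\<sigma> * (y - Y)) * \<tau>) = iexp (\<sigma> * \<tau> * Y) * iexp (- (\<sigma> * \<tau>) * y)" for y
      by (subst exp_add[symmetric]) (simp add: algebra_simps)
    then have "W \<tau> = (LINT y|lborel. iexp (\<sigma> * \<tau> * Y) * osc z c m \<psi> X (\<xi> + \<sigma> * \<tau>) y)"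
      unfolding W_def osc_modulate G_def by (simp only: mult.assoc)
    then show ?thesis by (simp add: norm_mult)
  qed
  have e: "exp (- \<tau>\<^sup>2 / 4) \<le> exp 1 * exp (- \<bar>\<tau>\<bar>)" for \<tau> :: real
  proof -
    have "0 \<le> (\<bar>\<tau>\<bar> / 2 - 1)\<^sup>2" by simp
    then have "- \<tau>\<^sup>2 / 4 \<le> 1 + - \<bar>\<tau>\<bar>" by (simp add: power2_diff power_divide)
    then show ?thesis by (simp flip: exp_add)
  qed
  have le: "exp (- \<tau>\<^sup>2 / 2) * cmod (W \<tau>) \<le> (D1 + D2 * exp (- T\<^sup>2 / 4)) * exp 1 * exp (- \<bar>\<tau>\<bar>)" for \<tau>
  proof -
    have "exp (- \<tau>\<^sup>2 / 4) * cmod (W \<tau>) \<le> D1 + D2 * exp (- T\<^sup>2 / 4)"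
    proof (cases "\<bar>\<tau>\<bar> \<le> T")
      case True
      have "exp (- \<tau>\<^sup>2 / 4) * cmod (W \<tau>) \<le> 1 * D1"
        using D1(2)[OF True] by (intro mult_mono) (auto simp: W)
      moreover have "D2 * exp (- T\<^sup>2 / 4) \<ge> 0" using D2 by simp
      ultimately show ?thesis by linarith
    next
      case False
      then have "T\<^sup>2 \<le> \<tau>\<^sup>2" using T by (metis abs_le_square_iff abs_of_nonneg linorder_le_cases)
      then have "exp (- \<tau>\<^sup>2 / 4) * cmod (W \<tau>) \<le> exp (- T\<^sup>2 / 4) * D2"
        using D2(2)[of \<tau>] by (intro mult_mono) (auto simp: W)
      then show ?thesis using D1 by (simp add: mult.commute)
    qed
    then have *: "exp (- \<tau>\<^sup>2 / 4) * (exp (- \<tau>\<^sup>2 / 4) * cmod (W \<tau>)) \<le>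
       (exp 1 * exp (- \<bar>\<tau>\<bar>)) * (D1 + D2 * exp (- T\<^sup>2 / 4))"
      by (intro mult_mono e) auto
    have **: "exp (- \<tau>\<^sup>2 / 4) * (exp (- \<tau>\<^sup>2 / 4) * cmod (W \<tau>)) = exp (- \<tau>\<^sup>2 / 2) * cmod (W \<tau>)"
    proof -
      have "exp (- \<tau>\<^sup>2 / 2) = exp (- \<tau>\<^sup>2 / 4) * exp (- \<tau>\<^sup>2 / 4)"
        by (subst exp_add[symmetric]) simp
      then show ?thesis by (simp only: mult.assoc)
    qed
    show ?thesis using * unfolding ** by (simp only: mult_ac)
  qed
  have "cmod (LINT \<tau>|lborel. of_real (exp (- \<tau>\<^sup>2 / 2)) * W \<tau>) \<le>
      (LINT \<tau>|lborel. (D1 + D2 * exp (- T\<^sup>2 / 4)) * exp 1 * exp (- \<bar>\<tau>\<bar>))"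
  \<comment> \<open>Without integrability the integral is 0 by convention and the nonnegative bound
    holds trivially.\<close>
  proof (cases "integrable lborel (\<lambda>\<tau>. of_real (exp (- \<tau>\<^sup>2 / 2)) * W \<tau>)")
    case True
    then show ?thesis
      by (rule Bochner_Integration.integral_norm_bound_integral)
         (use le integrable_exp_minus_abs in \<open>auto simp: norm_mult\<close>)
  next
    case False
    then show ?thesis using D1 D2 by (simp add: not_integrable_integral_eq)
  qed
  also have "\<dots> = (D1 + D2 * exp (- T\<^sup>2 / 4)) * exp 1 * (LINT y|lborel. exp (- \<bar>y\<bar>))" by simp
  also have "(LINT \<tau>|lborel. of_real (exp (- \<tau>\<^sup>2 / 2)) * W \<tau>) = of_real (sqrt (2 * pi) / \<sigma>) * S"
    unfolding W_def S_def by (rule gaussian_average) (use int \<sigma> in \<open>auto simp: G_def\<close>)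
  finally have "sqrt (2 * pi) * cmod S \<le> \<sigma> * ((D1 + D2 * exp (- T\<^sup>2 / 4)) * exp 1 * (LINT y|lborel. exp (- \<bar>y\<bar>)))"
    using \<sigma> by (simp add: norm_mult norm_divide field_simps)
  moreover have "1 \<le> sqrt (2 * pi)" using pi_gt3 by simp
  then have "1 * cmod S \<le> sqrt (2 * pi) * cmod S" by (intro mult_right_mono) auto
  ultimately show ?thesis by (simp add: S_def G_def)
qed

section \<open>Limit of the Gaussian average at a stationary point\<close>

lemma power_taylor2_bound:
  fixes x :: real
  obtains C where "C \<ge> 0"
    "\<And>h. \<bar>h\<bar> \<le> 1 \<Longrightarrow> \<bar>(x + h) ^ m - x ^ m - real m * x ^ (m - 1) * h\<bar> \<le> C * h\<^sup>2"
proof -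
  have "\<exists>C\<ge>0. \<forall>h. \<bar>h\<bar> \<le> 1 \<longrightarrow> \<bar>(x + h) ^ m - x ^ m - real m * x ^ (m - 1) * h\<bar> \<le> C * h\<^sup>2"
  proof (induction m)
    case (Suc m)
    then obtain C where C: "C \<ge> 0"
      "\<And>h. \<bar>h\<bar> \<le> 1 \<Longrightarrow> \<bar>(x + h) ^ m - x ^ m - real m * x ^ (m - 1) * h\<bar> \<le> C * h\<^sup>2" by blast
    define D where "D = real m * \<bar>x ^ (m - 1)\<bar>"
    show ?case
    proof (intro exI[of _ "C * (\<bar>x\<bar> + 1) + D"] conjI allI impI)
      fix h :: real assume h: "\<bar>h\<bar> \<le> 1"
      define R where "R = (x + h) ^ m - x ^ m - real m * x ^ (m - 1) * h"
      \<comment> \<open>Multiplying the expansion for \<open>m\<close> by \<open>x + h\<close>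
        creates a single new quadratic term. For \<open>m = 0\<close> the truncated exponent
        \<open>m - 1\<close> is harmless, because \<open>real m\<close> vanishes.\<close>
      have "(x + h) ^ Suc m - x ^ Suc m - real (Suc m) * x ^ (Suc m - 1) * h =
          R * (x + h) + real m * x ^ (m - 1) * h\<^sup>2"
        by (cases m) (auto simp: R_def algebra_simps power2_eq_square)
      also have "\<bar>\<dots>\<bar> \<le> \<bar>R\<bar> * \<bar>x + h\<bar> + D * h\<^sup>2"
        by (rule order_trans[OF abs_triangle_ineq]) (simp add: abs_mult D_def)
      also have "\<dots> \<le> C * h\<^sup>2 * (\<bar>x\<bar> + 1) + D * h\<^sup>2"
        unfolding R_def using C h by (intro add_right_mono mult_mono) auto
      finally show "\<bar>(x + h) ^ Suc m - x ^ Suc m - real (Suc m) * x ^ (Suc m - 1) * h\<bar> \<le>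
          (C * (\<bar>x\<bar> + 1) + D) * h\<^sup>2" by (simp add: algebra_simps)
    qed (use C in \<open>auto simp: D_def\<close>)
  qed auto
  then show ?thesis using that by blast
qed

text \<open>The frequency \<open>\<xi>\<close> is the derivative of \<open>c * y ^ m\<close> at
  \<open>Y\<close>, so the linear part of the difference cancels apart from \<open>z * h\<close>.
  With \<open>L = l powr t\<close> and \<open>k = h / L\<close> the remainder is at most
  \<open>\<bar>c\<bar> * (L ^ m * (C * k\<^sup>2))\<close>; for width
  \<open>l powr (- s / 2)\<close> this equals
  \<open>\<bar>c\<bar> * C * u\<^sup>2 / L\<close>.\<close>

lemma phase_taylor:
  fixes z :: complex and c x0 t l u :: real and m :: nat
  assumes l: "l \<ge> 1" and t: "t > 0" and m: "m \<ge> 1" and s: "s = t * (real m - 1)" "s > 0"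
    and u: "\<bar>u\<bar> \<le> l powr t"
    and C: "\<And>h. \<bar>h\<bar> \<le> 1 \<Longrightarrow> \<bar>(x0 + h) ^ m - x0 ^ m - real m * x0 ^ (m - 1) * h\<bar> \<le> C * h\<^sup>2" "C \<ge> 0"
  defines "Y \<equiv> l powr t * x0" and "\<xi> \<equiv> l powr s * (c * real m * x0 ^ (m - 1))"
    and "h \<equiv> u / l powr (s / 2)"
  shows "cmod (phase z c m \<xi> (of_real (Y + h)) - phase z c m \<xi> (of_real Y)) \<le>
     cmod z * (\<bar>u\<bar> * l powr (- s / 2)) + \<bar>c\<bar> * C * u\<^sup>2 * l powr (- t)"
proof -
  define L where "L = l powr t"
  define k where "k = h / L"
  have L: "L > 0" using l by (simp add: L_def)
  have ls: "l powr s = L ^ (m - 1)"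
    using m l by (simp add: L_def s powr_powr of_nat_diff flip: powr_realpow)
  have Lm: "L ^ m = l powr s * L" using m ls by (cases m) auto
  have hL: "h = L * k" using L by (simp add: k_def)
  have k1: "\<bar>k\<bar> \<le> 1"
  proof -
    have "1 \<le> l powr (s / 2)" using l s by (intro ge_one_powr_ge_zero) auto
    then have "\<bar>h\<bar> \<le> \<bar>u\<bar>" by (simp add: h_def divide_le_eq mult_le_cancel_left1)
    then have "\<bar>h\<bar> \<le> L" using u by (simp add: L_def)
    then show ?thesis using L by (simp add: k_def)
  qed
  define Q where "Q = (x0 + k) ^ m - x0 ^ m - real m * x0 ^ (m - 1) * k"
  have "Y + h = L * (x0 + k)" by (simp only: Y_def L_def[symmetric] hL distrib_left)
  then have 1: "(Y + h) ^ m = L ^ m * (x0 + k) ^ m" by (simp only: power_mult_distrib)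
  have Y: "Y = L * x0" by (simp only: Y_def L_def)
  have 2: "Y ^ m = L ^ m * x0 ^ m" by (simp only: Y power_mult_distrib)
  have "Y ^ (m - 1) * h = (L ^ (m - 1) * L) * (x0 ^ (m - 1) * k)"
    by (simp only: Y power_mult_distrib hL mult_ac)
  also have "L ^ (m - 1) * L = L ^ m" using m by (cases m) auto
  finally have 3: "Y ^ (m - 1) * h = L ^ m * (x0 ^ (m - 1) * k)" .
  have "c * ((Y + h) ^ m - Y ^ m) - \<xi> * h = c * ((Y + h) ^ m - Y ^ m - real m * (Y ^ (m - 1) * h))"
    by (simp add: \<xi>_def ls Y power_mult_distrib right_diff_distrib mult_ac)
  also have "\<dots> = c * (L ^ m * Q)"
    unfolding 1 2 3 Q_def by (simp add: right_diff_distrib mult_ac)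
  finally have eq: "c * ((Y + h) ^ m - Y ^ m) - \<xi> * h = c * (L ^ m * Q)" .
  have "phase z c m \<xi> (of_real (Y + h)) - phase z c m \<xi> (of_real Y) =
      z * of_real h + \<i> * of_real (c * ((Y + h) ^ m - Y ^ m) - \<xi> * h)"
    by (simp add: phase_def algebra_simps)
  also note eq
  finally have "cmod (phase z c m \<xi> (of_real (Y + h)) - phase z c m \<xi> (of_real Y)) = cmod (z * of_real h + \<i> * of_real (c * (L ^ m * Q)))"
    by (rule arg_cong)
  also have "\<dots> \<le> cmod z * \<bar>h\<bar> + \<bar>c * (L ^ m * Q)\<bar>"
    by (rule order_trans[OF norm_triangle_ineq]) (simp add: norm_mult del: of_real_mult)
  also have "\<bar>h\<bar> = \<bar>u\<bar> * l powr (- s / 2)"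
    by (simp add: h_def powr_minus_divide)
  also have "\<bar>c * (L ^ m * Q)\<bar> \<le> \<bar>c\<bar> * (L ^ m * (C * k\<^sup>2))"
    using C(1)[OF k1] L by (simp add: abs_mult Q_def mult_left_mono)
  also have "L ^ m * (C * k\<^sup>2) = C * u\<^sup>2 * l powr (- t)"
  proof -
    have "(l powr (s / 2))\<^sup>2 = l powr s" using l by (simp add: powr_power)
    then have "k\<^sup>2 = u\<^sup>2 / (l powr s * (L * L))"
      by (simp add: k_def h_def power_divide power2_eq_square)
    moreover have "l powr (- t) = 1 / L" by (simp add: L_def powr_minus_divide)
    moreover have "l powr s > 0" using l by simp
    ultimately show ?thesis using L by (simp add: Lm)
  qed
  finally show ?thesis by (simp add: mult_ac)
qed

text \<open>Dominated convergence after division by the value of the exponential at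
  \<open>Y l\<close>: for fixed \<open>u\<close> the phase difference tends to 0. The window is
  centred at \<open>Y l - w0\<close>, so that its argument tends to \<open>w0\<close>.\<close>

lemma stationary_average_tendsto:
  fixes z :: complex and c t s x0 w0 :: real and m :: nat
  assumes \<psi>: "\<psi> \<in> GS_space t s" and t: "0 < t" "t \<le> 1" and m: "m \<ge> 1"
    and s: "s = t * (real m - 1)" "s > 0"
  defines "Y \<equiv> \<lambda>l. l powr t * x0" and "\<xi> \<equiv> \<lambda>l. l powr s * (c * real m * x0 ^ (m - 1))"
  shows "((\<lambda>l. (LINT u|lborel. of_real (exp (- u\<^sup>2 / 2)) *
      osc z c m \<psi> (Y l - w0) (\<xi> l) (Y l + u / l powr (s / 2))) / exp (phase z c m (\<xi> l) (of_real (Y l))))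
      \<longlongrightarrow> of_real (sqrt (2 * pi)) * cnj (\<psi> w0)) at_top"
proof -
  define b where "b = cmod z"
  define h where "h l u = u / l powr (s / 2)" for l u
  define d where "d l u = phase z c m (\<xi> l) (of_real (Y l + h l u)) - phase z c m (\<xi> l) (of_real (Y l))" for l u
  have b: "b \<ge> 0" by (simp add: b_def)
  have cont: "continuous_on UNIV \<psi>" by (rule GS_space_continuous[OF \<psi>])
  obtain C where C: "C \<ge> 0" "\<And>n w. exp (0 * \<bar>w\<bar>) * cmod (nth_vderiv n \<psi> w) \<le>
     C * exp (- \<bar>w\<bar>) * exp (- 0 * \<bar>w\<bar> powr (1 / t)) * 1 ^ n * fact n powr s"
    using GS_deriv_weighted_decay[OF \<psi> t, of 0 0 1] by auto
  have \<psi>_le: "cmod (\<psi> w) \<le> C" for w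
  proof -
    have "cmod (\<psi> w) \<le> C * exp (- \<bar>w\<bar>)" using C(2)[of w 0] by (simp add: nth_vderiv_def)
    also have "\<dots> \<le> C * 1" using C(1) by (intro mult_left_mono) auto
    finally show ?thesis by simp
  qed
  obtain C' where C': "C' \<ge> 0"
    "\<And>h. \<bar>h\<bar> \<le> 1 \<Longrightarrow> \<bar>(x0 + h) ^ m - x0 ^ m - real m * x0 ^ (m - 1) * h\<bar> \<le> C' * h\<^sup>2"
    using power_taylor2_bound[of x0 m] by blast
  have eq: "of_real (exp (- u\<^sup>2 / 2)) * osc z c m \<psi> (Y l - w0) (\<xi> l) (Y l + u / l powr (s / 2))
        / exp (phase z c m (\<xi> l) (of_real (Y l))) =
        of_real (exp (- u\<^sup>2 / 2)) * (exp (d l u) * cnj (\<psi> (w0 + h l u)))" for l u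
      by (simp add: osc_def d_def exp_diff add.commute flip: h_def)
  have "((\<lambda>l. LINT u|lborel. of_real (exp (- u\<^sup>2 / 2)) * (exp (d l u) * cnj (\<psi> (w0 + h l u))))
     \<longlongrightarrow> (LINT u|lborel. of_real (exp (- u\<^sup>2 / 2)) * cnj (\<psi> w0))) at_top"
  proof (rule integral_dominated_convergence_at_top
      [where w = "\<lambda>u. C * exp ((b + 1)\<^sup>2 / 2) * exp (- \<bar>u\<bar>)"])
    show "AE u in lborel. ((\<lambda>l. of_real (exp (- u\<^sup>2 / 2)) * (exp (d l u) * cnj (\<psi> (w0 + h l u))))
        \<longlongrightarrow> of_real (exp (- u\<^sup>2 / 2)) * cnj (\<psi> w0)) at_top"
    proof (rule AE_I2)
      fix u :: real
      have h0: "((\<lambda>l. h l u) \<longlongrightarrow> 0) at_top"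
        unfolding h_def using s(2) by real_asymp
      have "((\<lambda>l. d l u) \<longlongrightarrow> 0) at_top"
      proof (rule Lim_null_comparison)
        show "((\<lambda>l. cmod z * (\<bar>u\<bar> * l powr (- s / 2)) + \<bar>c\<bar> * C' * u\<^sup>2 * l powr (- t)) \<longlongrightarrow> 0) at_top"
        proof -
          have "((\<lambda>l. l powr (- s / 2)) \<longlongrightarrow> 0) at_top" "((\<lambda>l. l powr (- t)) \<longlongrightarrow> 0) at_top"
            using s(2) t(1) by real_asymp+
          then have "((\<lambda>l. cmod z * (\<bar>u\<bar> * l powr (- s / 2)) + \<bar>c\<bar> * C' * u\<^sup>2 * l powr (- t))
              \<longlongrightarrow> cmod z * (\<bar>u\<bar> * 0) + \<bar>c\<bar> * C' * u\<^sup>2 * 0) at_top"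
            by (intro tendsto_intros)
          then show ?thesis by simp
        qed
        have "eventually (\<lambda>l. \<bar>u\<bar> \<le> l powr t) at_top" using t by real_asymp
        then show "eventually (\<lambda>l. cmod (d l u) \<le>
            cmod z * (\<bar>u\<bar> * l powr (- s / 2)) + \<bar>c\<bar> * C' * u\<^sup>2 * l powr (- t)) at_top"
          using eventually_ge_at_top[of 1]
        proof eventually_elim
          case (elim l)
          show ?case unfolding d_def Y_def \<xi>_def h_def
            by (rule phase_taylor) (use elim t m s C' in auto)
        qed
      qed
      then have "((\<lambda>l. exp (d l u)) \<longlongrightarrow> exp 0) at_top" by (rule tendsto_exp)
      moreover have "isCont \<psi> w0" using cont by (simp add: continuous_on_eq_continuous_at)
      then have "((\<lambda>l. \<psi> (w0 + h l u)) \<longlongrightarrow> \<psi> w0) at_top"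
        by (rule isCont_tendsto_compose) (use tendsto_add[OF tendsto_const h0] in simp)
      ultimately have "((\<lambda>l. of_real (exp (- u\<^sup>2 / 2)) * (exp (d l u) * cnj (\<psi> (w0 + h l u))))
          \<longlongrightarrow> of_real (exp (- u\<^sup>2 / 2)) * (exp 0 * cnj (\<psi> w0))) at_top"
        by (intro tendsto_mult tendsto_const tendsto_cnj)
      then show "((\<lambda>l. of_real (exp (- u\<^sup>2 / 2)) * (exp (d l u) * cnj (\<psi> (w0 + h l u))))
        \<longlongrightarrow> of_real (exp (- u\<^sup>2 / 2)) * cnj (\<psi> w0)) at_top" by simp
    qed
    show "eventually (\<lambda>l. AE u in lborel. norm (of_real (exp (- u\<^sup>2 / 2)) * (exp (d l u) * cnj (\<psi> (w0 + h l u))))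
       \<le> C * exp ((b + 1)\<^sup>2 / 2) * exp (- \<bar>u\<bar>)) at_top"
      using eventually_ge_at_top[of 1]
    proof (rule eventually_mono, intro AE_I2)
      fix l u :: real assume l: "1 \<le> l"
      have "1 \<le> l powr (s / 2)" using l s by (intro ge_one_powr_ge_zero) auto
      then have "\<bar>h l u\<bar> \<le> \<bar>u\<bar>" by (simp add: h_def divide_le_eq mult_le_cancel_left1)
      then have "b * \<bar>h l u\<bar> \<le> b * \<bar>u\<bar>" using b by (rule mult_left_mono)
      moreover have "Re z * h l u \<le> b * \<bar>h l u\<bar>"
        using exp_Re_le[of z "h l u" 0] by (simp add: b_def flip: exp_add)
      \<comment> \<open>Only \<open>Re z\<close> enters the modulus, so the domination holds for
        every \<open>u\<close>, including those beyond the range of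
        \<open>phase_taylor\<close>.\<close>
      moreover have "Re (d l u) = Re z * h l u" by (simp add: d_def algebra_simps del: of_real_add)
      ultimately have "cmod (exp (d l u)) \<le> exp (b * \<bar>u\<bar>)" by simp
      then have "cmod (exp (d l u)) * cmod (\<psi> (w0 + h l u)) \<le> exp (b * \<bar>u\<bar>) * C"
        by (intro mult_mono \<psi>_le) auto
      then have "exp (- u\<^sup>2 / 2) * (cmod (exp (d l u)) * cmod (\<psi> (w0 + h l u))) \<le>
          exp (- u\<^sup>2 / 2) * (exp (b * \<bar>u\<bar>) * C)"
        by (rule mult_left_mono) simp
      also have "\<dots> = C * (exp (b * \<bar>u\<bar>) * exp (- u\<^sup>2 / 2))" by (simp only: mult_ac)
      also have "\<dots> \<le> C * (exp ((b + 1)\<^sup>2 / 2) * exp (- \<bar>u\<bar>))"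
        using C(1) by (intro mult_left_mono gaussian_le_exp_minus_abs)
      finally show "norm (of_real (exp (- u\<^sup>2 / 2)) * (exp (d l u) * cnj (\<psi> (w0 + h l u))))
         \<le> C * exp ((b + 1)\<^sup>2 / 2) * exp (- \<bar>u\<bar>)"
        by (simp add: norm_mult mult.assoc)
    qed
    show "integrable lborel (\<lambda>u. C * exp ((b + 1)\<^sup>2 / 2) * exp (- \<bar>u\<bar>))"
      by (intro integrable_mult_right integrable_exp_minus_abs)
    have [measurable]: "osc z c m \<psi> X' \<xi>' \<in> borel_measurable borel" for X' \<xi>'
      by (rule osc_borel[OF cont])
    show "(\<lambda>u. of_real (exp (- u\<^sup>2 / 2)) * (exp (d l u) * cnj (\<psi> (w0 + h l u)))) \<in> borel_measurable lborel" for l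
      unfolding eq[symmetric] by measurable
    show "(\<lambda>u. of_real (exp (- u\<^sup>2 / 2)) * cnj (\<psi> w0)) \<in> borel_measurable lborel" by measurable
  qed
  moreover have "(LINT u|lborel. of_real (exp (- u\<^sup>2 / 2)) * cnj (\<psi> w0)) = of_real (sqrt (2 * pi)) * cnj (\<psi> w0)"
    using gaussian_fourier[of 0] by simp
  moreover have "(LINT u|lborel. of_real (exp (- u\<^sup>2 / 2)) *
      osc z c m \<psi> (Y l - w0) (\<xi> l) (Y l + u / l powr (s / 2))) / exp (phase z c m (\<xi> l) (of_real (Y l))) =
    (LINT u|lborel. of_real (exp (- u\<^sup>2 / 2)) * (exp (d l u) * cnj (\<psi> (w0 + h l u))))" for l
    unfolding eq[symmetric] by (rule integral_divide_zero[symmetric])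
  ultimately show ?thesis by (simp only:)
qed

text \<open>The normalised average \<open>S l / exp (P l)\<close> has a nonzero limit, while the
  assumed decay would force it to 0. In the assumed rate, \<open>cmod z * \<bar>x0\<bar>\<close>
  compensates the smallest possible size of \<open>exp (P l)\<close>, and the additional 1 leaves
  \<open>exp (- l)\<close> against a power of \<open>l\<close>.\<close>

lemma stationary_no_decay:
  fixes z :: complex and c t s x0 e M :: real and m :: nat
  assumes \<psi>: "\<psi> \<in> GS_space t s" "\<psi> \<noteq> (\<lambda>x. 0)" and t: "0 < t" "t \<le> 1" and m: "m \<ge> 1"
    and s: "s = t * (real m - 1)" "s > 1" and e: "e > 0"
    and dec: "\<And>l x \<xi>. l > 0 \<Longrightarrow> \<bar>x - x0\<bar> < e \<Longrightarrow> \<bar>\<xi> - c * real m * x0 ^ (m - 1)\<bar> < e \<Longrightarrow>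
      exp ((cmod z * \<bar>x0\<bar> + 1) * l) * cmod (LINT y|lborel. osc z c m \<psi> (l powr t * x) (l powr s * \<xi>) y) \<le> M"
  shows False
proof -
  define b where "b = cmod z"
  define J where "J = (LINT y|lborel. exp (- \<bar>y::real\<bar>))"
  define \<xi>0 where "\<xi>0 = c * real m * x0 ^ (m - 1)"
  define Y where "Y l = l powr t * x0" for l
  define \<xi> where "\<xi> l = l powr s * \<xi>0" for l
  obtain w0 where w0: "\<psi> w0 \<noteq> 0" using \<psi>(2) by auto
  have bJ: "b \<ge> 0" "J \<ge> 0" by (auto simp: b_def J_def)
  have cont: "continuous_on UNIV \<psi>" by (rule GS_space_continuous[OF \<psi>(1)])
  obtain C where C: "C \<ge> 0" "\<And>n w. exp (b * \<bar>w\<bar>) * cmod (nth_vderiv n \<psi> w) \<le>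
     C * exp (- \<bar>w\<bar>) * exp (- 0 * \<bar>w\<bar> powr (1 / t)) * 1 ^ n * fact n powr s"
    using GS_deriv_weighted_decay[OF \<psi>(1) t order.refl bJ(1), of 1] by auto
  have C0: "exp (cmod z * \<bar>w\<bar>) * cmod (\<psi> w) \<le> C * exp (- \<bar>w\<bar>) * exp (- 0 * \<bar>w\<bar> powr (1 / t))" for w
    using C(2)[of w 0] by (simp add: nth_vderiv_def b_def)
  note bound = osc_integral_bound[OF cont C(1) order.refl t(1) order.refl C0]
  define S where "S l = (LINT u|lborel. of_real (exp (- u\<^sup>2 / 2)) *
      osc z c m \<psi> (Y l - w0) (\<xi> l) (Y l + u / l powr (s / 2)))" for l
  define P where "P l = phase z c m (\<xi> l) (of_real (Y l))" for l
  have lim: "((\<lambda>l. S l / exp (P l)) \<longlongrightarrow> of_real (sqrt (2 * pi)) * cnj (\<psi> w0)) at_top"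
    unfolding S_def P_def Y_def \<xi>_def \<xi>0_def
    by (rule stationary_average_tendsto[OF \<psi>(1) t m s(1)]) (use s in simp)
  define A where "A = (\<bar>M\<bar> + C * J * exp (b * \<bar>w0\<bar>)) * exp 1 * J"
  \<comment> \<open>This places \<open>x0 - w0 / l powr t\<close>, the rescaled window centre, in
    the neighbourhood where decay is assumed.\<close>
  have "eventually (\<lambda>l. \<bar>w0\<bar> < e * l powr t) at_top" using t e by real_asymp
  \<comment> \<open>Here \<open>s > 1\<close> is decisive: the tail
    \<open>exp (- T\<^sup>2 / 4)\<close>, with exponent of order \<open>l powr s\<close>, must beat
    the growth \<open>b * \<bar>x0\<bar> * l\<close> in \<open>D2\<close> and still supply the rate
    \<open>b * \<bar>x0\<bar> + 1\<close>.\<close>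
  moreover have "eventually (\<lambda>l. 16 * (2 * b * \<bar>x0\<bar> + 1) / e\<^sup>2 \<le> l powr (s - 1)) at_top"
    using s by real_asymp
  ultimately have "eventually (\<lambda>l. cmod (S l / exp (P l)) \<le> l powr (s / 2) * exp (- l) * A) at_top"
    using eventually_ge_at_top[of 1]
  proof eventually_elim
    case (elim l)
    define \<sigma> where "\<sigma> = l powr (s / 2)"
    \<comment> \<open>As \<open>\<sigma> * \<sigma> = l powr s\<close>, a shift by
      \<open>\<sigma> * \<tau>\<close> moves the rescaled frequency by
      \<open>\<tau> / \<sigma>\<close>, which stays below \<open>e\<close> for
      \<open>\<bar>\<tau>\<bar> \<le> T\<close>.\<close>
    define T where "T = e / 2 * \<sigma>"
    define D1 where "D1 = \<bar>M\<bar> * exp (- (b * \<bar>x0\<bar> + 1) * l)"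
    define D2 where "D2 = exp (b * \<bar>Y l - w0\<bar>) * C * J"
    have \<sigma>: "\<sigma> > 0" using elim by (simp add: \<sigma>_def)
    have \<sigma>2: "\<sigma> * \<sigma> = l powr s" by (simp add: \<sigma>_def flip: powr_add)
    have lt: "l powr t \<le> l" using powr_mono[of t 1 l] t elim by simp
    have "\<bar>Y l\<bar> \<le> l * \<bar>x0\<bar>" using mult_right_mono[OF lt, of "\<bar>x0\<bar>"] by (simp add: Y_def abs_mult)
    then have bY: "b * \<bar>Y l\<bar> \<le> b * \<bar>x0\<bar> * l" using mult_left_mono[OF _ bJ(1)] by (fastforce simp: mult_ac)
    have "cmod (S l) \<le> \<sigma> * ((D1 + D2 * exp (- T\<^sup>2 / 4)) * exp 1 * J)"
      unfolding S_def J_def \<sigma>_def[symmetric]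
    proof (rule gaussian_average_osc_le)
      show "integrable lborel (osc z c m \<psi> (Y l - w0) (\<xi> l))" by (rule bound(1))
      fix \<tau> :: real
      show "cmod (LINT y|lborel. osc z c m \<psi> (Y l - w0) (\<xi> l + \<sigma> * \<tau>) y) \<le> D2"
        using bound(2)[of c m "Y l - w0" "\<xi> l + \<sigma> * \<tau>"] t by (simp add: D2_def J_def b_def)
      assume "\<bar>\<tau>\<bar> \<le> T"
      then have "\<bar>\<tau> / \<sigma>\<bar> \<le> e / 2" using \<sigma> by (simp add: T_def divide_le_eq)
      then have "\<bar>\<tau> / \<sigma>\<bar> < e" using e by linarith
      then have "\<bar>\<xi>0 + \<tau> / \<sigma> - c * real m * x0 ^ (m - 1)\<bar> < e"
        by (simp only: \<xi>0_def add_diff_cancel_left')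
      moreover have "\<bar>(x0 - w0 / l powr t) - x0\<bar> < e" using elim by (simp add: divide_less_eq)
      moreover have "l powr t * (x0 - w0 / l powr t) = Y l - w0"
        using elim by (simp add: Y_def right_diff_distrib)
      moreover have "l powr s * (\<xi>0 + \<tau> / \<sigma>) = \<xi> l + \<sigma> * \<tau>"
        using \<sigma> by (simp add: \<xi>_def distrib_left flip: \<sigma>2)
      ultimately have "exp ((b * \<bar>x0\<bar> + 1) * l) *
          cmod (LINT y|lborel. osc z c m \<psi> (Y l - w0) (\<xi> l + \<sigma> * \<tau>) y) \<le> M"
        using dec[of l "x0 - w0 / l powr t" "\<xi>0 + \<tau> / \<sigma>"] elim by (simp add: b_def)
      also have "M \<le> \<bar>M\<bar>" by simp
      finally show "cmod (LINT y|lborel. osc z c m \<psi> (Y l - w0) (\<xi> l + \<sigma> * \<tau>) y) \<le> D1"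
        unfolding D1_def minus_mult_left[symmetric] exp_minus by (simp add: field_simps)
    qed (use \<sigma> e bJ C in \<open>auto simp: T_def D1_def D2_def\<close>)
    also have "D1 + D2 * exp (- T\<^sup>2 / 4) \<le> (\<bar>M\<bar> + C * J * exp (b * \<bar>w0\<bar>)) * exp (- (b * \<bar>x0\<bar> + 1) * l)"
    proof -
      have "T\<^sup>2 / 4 = e\<^sup>2 / 16 * (l powr (s - 1) * l)"
      proof -
        have "T\<^sup>2 = e\<^sup>2 / 4 * l powr s"
          by (simp add: T_def power_mult_distrib power_divide power2_eq_square[of \<sigma>] \<sigma>2)
        moreover have "l powr s = l powr (s - 1) * l"
          using elim by (simp add: powr_diff)
        ultimately show ?thesis by simp
      qed
      moreover have "(2 * b * \<bar>x0\<bar> + 1) * l \<le> e\<^sup>2 / 16 * l powr (s - 1) * l"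
        using elim e by (intro mult_right_mono) (auto simp: field_simps)
      moreover have "b * \<bar>Y l - w0\<bar> \<le> b * \<bar>Y l\<bar> + b * \<bar>w0\<bar>"
        using mult_left_mono[OF abs_triangle_ineq4 bJ(1), of "Y l" w0] by (simp add: distrib_left)
      ultimately have "b * \<bar>Y l - w0\<bar> + - T\<^sup>2 / 4 \<le> b * \<bar>w0\<bar> + - (b * \<bar>x0\<bar> + 1) * l"
        using bY by (simp add: algebra_simps)
      then have "exp (b * \<bar>Y l - w0\<bar>) * exp (- T\<^sup>2 / 4) \<le> exp (b * \<bar>w0\<bar>) * exp (- (b * \<bar>x0\<bar> + 1) * l)"
        by (simp only: exp_le_cancel_iff flip: exp_add)
      then have "C * J * (exp (b * \<bar>Y l - w0\<bar>) * exp (- T\<^sup>2 / 4)) \<le>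
          C * J * (exp (b * \<bar>w0\<bar>) * exp (- (b * \<bar>x0\<bar> + 1) * l))"
        using C bJ by (intro mult_left_mono) auto
      then have "D2 * exp (- T\<^sup>2 / 4) \<le> C * J * exp (b * \<bar>w0\<bar>) * exp (- (b * \<bar>x0\<bar> + 1) * l)"
        by (simp only: D2_def mult_ac)
      then show ?thesis unfolding distrib_right D1_def by linarith
    qed
    finally have S_le: "cmod (S l) \<le> \<sigma> * (exp (- (b * \<bar>x0\<bar> + 1) * l) * A)"
      using \<sigma> bJ by (simp add: A_def mult_left_mono mult_right_mono mult_ac)
    have "- (b * \<bar>x0\<bar> * l) \<le> Re z * Y l"
    proof -
      have "\<bar>Re z * Y l\<bar> \<le> b * \<bar>Y l\<bar>"
        unfolding abs_mult b_def by (intro mult_right_mono abs_Re_le_cmod) auto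
      then show ?thesis using bY by linarith
    qed
    then have "exp (- (b * \<bar>x0\<bar> * l)) \<le> cmod (exp (P l))" by (simp add: P_def)
    then have "cmod (S l / exp (P l)) \<le> \<sigma> * (exp (- (b * \<bar>x0\<bar> + 1) * l) * A) / exp (- (b * \<bar>x0\<bar> * l))"
      unfolding norm_divide by (intro frac_le S_le) (use \<sigma> C bJ in \<open>auto simp: A_def\<close>)
    also have "\<dots> = \<sigma> * (exp (- (b * \<bar>x0\<bar> + 1) * l) / exp (- (b * \<bar>x0\<bar> * l))) * A" by simp
    also have "exp (- (b * \<bar>x0\<bar> + 1) * l) / exp (- (b * \<bar>x0\<bar> * l)) = exp (- l)"
      by (simp add: algebra_simps flip: exp_diff)
    finally show ?case by (simp add: \<sigma>_def)
  qed
  moreover have "((\<lambda>l. l powr (s / 2) * exp (- l) * A) \<longlongrightarrow> 0) at_top"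
    by real_asymp
  ultimately have "((\<lambda>l. S l / exp (P l)) \<longlongrightarrow> 0) at_top"
    by (rule Lim_null_comparison)
  from tendsto_unique[OF _ lim this] w0 show False by simp
qed

section \<open>The wave front set\<close>

theorem proposition8p5:
  fixes z :: complex and c t :: real and m :: nat and v \<psi> :: "real \<Rightarrow> complex"
  assumes "c \<noteq> 0" and "m \<ge> 2"
    and "v = (\<lambda>x. exp (z * of_real x + \<i> * of_real c * of_real x ^ m))"
    and "1 / (real m - 1) < t" and "t \<le> 1"
    and "\<psi> \<in> GS_space t (t * (real m - 1))" and "\<psi> \<noteq> (\<lambda>x. 0)"
  shows "WF \<psi> t (t * (real m - 1)) (functional_of v) =
         {(x, c * real m * x ^ (m - 1)) | x. x \<noteq> 0}"
proof -
  define s where "s = t * (real m - 1)"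
  \<comment> \<open>The lower bound on \<open>t\<close> says precisely that \<open>s\<close> exceeds
    1.\<close>
  have s: "s > 1" using assms(2,4) by (simp add: s_def field_simps)
  have m: "m \<ge> 1" using assms(2) by simp
  have "0 < 1 / (real m - 1)" using assms(2) by simp
  with assms(4,5) have t: "0 < t" "t \<le> 1" by linarith+
  have \<psi>: "\<psi> \<in> GS_space t s" using assms(6) by (simp add: s_def)
  define k :: real where "k = (2 * pi) powr (- 1 / 2)"
  have k: "k > 0" by (simp add: k_def)
  define W where "W x \<xi> = cmod (LINT y|lborel. osc z c m \<psi> x \<xi> y)" for x \<xi>
  have STFT: "cmod (STFT \<psi> (functional_of v) x \<xi>) = k * W x \<xi>" for x \<xi>
    using k unfolding assms(3) STFT_eq_osc k_def[symmetric] by (simp add: W_def norm_mult)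
  have "p \<in> WF \<psi> t s (functional_of v) \<longleftrightarrow> (\<exists>x. p = (x, c * real m * x ^ (m - 1)) \<and> x \<noteq> 0)" for p
  proof
    assume p: "p \<in> WF \<psi> t s (functional_of v)"
    obtain x0 \<xi>0 where p_eq: "p = (x0, \<xi>0)" by fastforce
    from p have nz: "p \<noteq> (0, 0)" and
      no: "\<And>U. open U \<Longrightarrow> U \<subseteq> UNIV - {(0, 0)} \<Longrightarrow> p \<in> U \<Longrightarrow>
        \<forall>r>0. bdd_above {exp (r * l) * cmod (STFT \<psi> (functional_of v) (l powr t * x) (l powr s * \<xi>))
          | l x \<xi>. l > 0 \<and> (x, \<xi>) \<in> U} \<Longrightarrow> False"
      unfolding WF_def mem_Collect_eq by blast+
    have "\<xi>0 = c * real m * x0 ^ (m - 1)"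
    proof (rule ccontr)
      assume "\<xi>0 \<noteq> c * real m * x0 ^ (m - 1)"
      from nonstationary_decay[OF \<psi> t m s_def less_imp_le[OF s] this, of z]
      obtain \<delta> where \<delta>: "\<delta> > 0"
        "\<And>r. \<exists>M. \<forall>l x \<xi>. l > 0 \<longrightarrow> \<bar>x - x0\<bar> < \<delta> \<longrightarrow> \<bar>\<xi> - \<xi>0\<bar> < \<delta> \<longrightarrow>
          exp (r * l) * W (l powr t * x) (l powr s * \<xi>) \<le> M"
        unfolding W_def by blast
      \<comment> \<open>The product of intervals may contain the origin, which has to be removed;
        \<open>p\<close> itself survives as it is nonzero.\<close>
      define U where "U = ball x0 \<delta> \<times> ball \<xi>0 \<delta> - {(0, 0)}"
      have U1: "open U" unfolding U_def by (intro open_Diff open_Times) auto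
      have U2: "U \<subseteq> UNIV - {(0, 0)}" "p \<in> U" using nz \<delta> by (auto simp: U_def p_eq)
      have bdd: "bdd_above {exp (r * l) * cmod (STFT \<psi> (functional_of v) (l powr t * x) (l powr s * \<xi>))
          | l x \<xi>. l > 0 \<and> (x, \<xi>) \<in> U}" for r
      proof -
        obtain M where M: "\<And>l x \<xi>. l > 0 \<Longrightarrow> \<bar>x - x0\<bar> < \<delta> \<Longrightarrow> \<bar>\<xi> - \<xi>0\<bar> < \<delta> \<Longrightarrow>
          exp (r * l) * W (l powr t * x) (l powr s * \<xi>) \<le> M"
          using \<delta>(2)[of r] by blast
        have "exp (r * l) * cmod (STFT \<psi> (functional_of v) (l powr t * x) (l powr s * \<xi>)) \<le> k * M"
          if "l > 0" "(x, \<xi>) \<in> U" for l x \<xi>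
        proof -
          have "exp (r * l) * W (l powr t * x) (l powr s * \<xi>) \<le> M"
            using that by (intro M) (auto simp: U_def dist_real_def abs_minus_commute)
          then have "k * (exp (r * l) * W (l powr t * x) (l powr s * \<xi>)) \<le> k * M"
            using k by (intro mult_left_mono) auto
          then show ?thesis by (simp only: STFT mult_ac)
        qed
        then show ?thesis by (intro bdd_aboveI[where M = "k * M"]) blast
      qed
      show False by (rule no[OF U1 U2]) (intro allI impI bdd)
    qed
    \<comment> \<open>Since \<open>m - 1\<close> is positive, the curve passes through
      \<open>x = 0\<close> only at the origin, which \<open>p\<close> is not.\<close>
    moreover have "x0 \<noteq> 0"
      using nz calculation assms(2) by (auto simp: p_eq)
    ultimately show "\<exists>x. p = (x, c * real m * x ^ (m - 1)) \<and> x \<noteq> 0" by (simp add: p_eq)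
  next
    assume "\<exists>x. p = (x, c * real m * x ^ (m - 1)) \<and> x \<noteq> 0"
    then obtain x0 where p: "p = (x0, c * real m * x0 ^ (m - 1))" "x0 \<noteq> 0" by blast
    have False if U: "open U" "p \<in> U" and bdd: "\<forall>r>0. bdd_above
        {exp (r * l) * cmod (STFT \<psi> (functional_of v) (l powr t * x) (l powr s * \<xi>))
          | l x \<xi>. l > 0 \<and> (x, \<xi>) \<in> U}" for U
    proof -
      \<comment> \<open>This single rate is the one refuted by
        \<open>stationary_no_decay\<close>.\<close>
      define r where "r = cmod z * \<bar>x0\<bar> + 1"
      have "r > 0" by (simp add: r_def add_nonneg_pos)
      with bdd obtain M where M: "\<And>l x \<xi>. l > 0 \<Longrightarrow> (x, \<xi>) \<in> U \<Longrightarrow>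
          exp (r * l) * cmod (STFT \<psi> (functional_of v) (l powr t * x) (l powr s * \<xi>)) \<le> M"
        unfolding bdd_above_def by blast
      obtain A B where AB: "open A" "open B" "(x0, c * real m * x0 ^ (m - 1)) \<in> A \<times> B" "A \<times> B \<subseteq> U"
        by (rule open_prod_elim[OF U(1) U(2)[unfolded p(1)]])
      obtain d1 d2 where d: "d1 > 0" "ball x0 d1 \<subseteq> A" "d2 > 0" "ball (c * real m * x0 ^ (m - 1)) d2 \<subseteq> B"
        using AB by (metis mem_Sigma_iff open_contains_ball)
      show False
      proof (rule stationary_no_decay[OF \<psi> assms(7) t m s_def s, of "min d1 d2" x0 c z "M / k"])
        fix l x \<xi> :: real
        assume *: "l > 0" "\<bar>x - x0\<bar> < min d1 d2" "\<bar>\<xi> - c * real m * x0 ^ (m - 1)\<bar> < min d1 d2"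
        then have "(x, \<xi>) \<in> U"
          using d AB by (auto simp: subset_iff dist_real_def abs_minus_commute)
        from M[OF *(1) this] have "k * (exp (r * l) * W (l powr t * x) (l powr s * \<xi>)) \<le> M"
          by (simp only: STFT mult_ac)
        then show "exp ((cmod z * \<bar>x0\<bar> + 1) * l) *
            cmod (LINT y|lborel. osc z c m \<psi> (l powr t * x) (l powr s * \<xi>) y) \<le> M / k"
          using k by (simp add: W_def r_def pos_le_divide_eq mult_ac)
      qed (use d in auto)
    qed
    moreover have "p \<noteq> (0, 0)" using p by simp
    ultimately show "p \<in> WF \<psi> t s (functional_of v)" unfolding WF_def by blast
  qed
  then show ?thesis unfolding s_def[symmetric] by blast
qed

end
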